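(* Let $n=2$ and let $\Delta\subset\mathbb Z^2$ be an additive semigroup. Let $\pi=\frac t2\pi_1+\sum_{k\ge2}t^k\pi_k$, with $\pi_k\in C^2$ for all $k\ge 1$ and $\pi_1$ a Poisson bivector, be a solution of the Maurer–Cartan equation $\delta\pi=\frac12[\pi,\pi]$ (as formal power series in $t$). If $\pi_1\in C_\Delta$, then the $\pi_k$, $k\ge2$, can be chosen from $I^{(2)}_\Delta$; that is, there exist $\pi'_k\in C^2\cap I^{(2)}_\Delta$, $k\ge2$, such that $\pi'=\frac t2\pi_1+\sum_{k\ge2}t^k\pi'_k$ satisfies $\delta\pi'=\frac12[\pi',\pi']$.
   Context: Let $A=\mathbb R[x_1,\ldots,x_n]$ (here $n=2$). For $p\ge 0$ let $C^p$ be the real vector space of multilinear maps $\varphi:A^p\to A$ that are finite sums $\varphi=\sum \varphi_{a_0a_1\ldots a_p}\,x^{a_0}\partial^{a_1}\otimes\cdots\otimes\partial^{a_p}$, with $\varphi_{a_0\ldots a_p}\in\mathbb R$ and multi-indices $a_0,\ldots,a_p\in\mathbb N^n$ ($\mathbb N$ includes $0$), where $x^a=x_1^{a^1}\cdots x_n^{a^n}$, $\partial^a=\partial_1^{a^1}\cdots\partial_n^{a^n}$, $\partial_i=\partial/\partial x_i$, and $(x^{a_0}\partial^{a_1}\otimes\cdots\otimes\partial^{a_p})(u_1,\ldots,u_p)=x^{a_0}(\partial^{a_1}u_1)\cdots(\partial^{a_p}u_p)$. So $C^0=A$. Put $C=\bigoplus_{p\ge0}C^p$. For $\varphi\in C^p$,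 $\psi\in C^q$ the Gerstenhaber bracket is $[\varphi,\psi](u_1,\ldots,u_{p+q-1})=\sum_{k=1}^p(-1)^{(k-1)(q-1)}\varphi(u_1,\ldots,u_{k-1},\psi(u_k,\ldots,u_{k+q-1}),u_{k+q},\ldots,u_{p+q-1})-(-1)^{(p-1)(q-1)}\sum_{k=1}^q(-1)^{(k-1)(p-1)}\psi(u_1,\ldots,u_{k-1},\varphi(u_k,\ldots,u_{k+p-1}),u_{k+p},\ldots,u_{p+q-1})$ (empty sums are $0$; the bracket of two elements of $C^0$ is $0$). The Hochschild coboundary is $\delta\varphi(u_1,\ldots,u_{p+1})=u_1\varphi(u_2,\ldots,u_{p+1})+\sum_{k=1}^p(-1)^k\varphi(u_1,\ldots,u_{k-1},u_ku_{k+1},u_{k+2},\ldots,u_{p+1})+(-1)^{p+1}\varphi(u_1,\ldots,u_p)u_{p+1}$. Both operations are extended $t$-linearly, coefficientwise, to formal power series in $t$ with coefficients in the spaces $C^p$. The Maurer–Cartan equation for $\pi$ is the associativity condition for the star product $f\ast g=fg+\pi(f,g)$. A Poisson bivector on $\mathbb R^2$ here is an element of $C^2$ of the form $(f,g)\mapsto P\,(\partial_1f\,\partial_2g-\partial_2f\,\partial_1g)$ with $P\in A$ (in dimension 2 the Jacobi identity is automatic). For $a\in\mathbb Z^n$, $C_a\subset C$ is the linear span of all $x^{a_0}\partial^{a_1}\otimes\cdots\otimes\partial^{a_p}$, $p\ge0$, with $a_0-\sum_{s=1}^pa_s=a$; one has $C=\bigoplus_{a\in\mathbb Z^n}C_a$.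 An additive semigroup $\Delta\subset\mathbb Z^n$ is a subset closed under addition. $C_\Delta=\bigoplus_{a\in\Delta}C_a$, and $I^{(2)}_\Delta=\bigoplus_{c\in\Delta+\Delta}C_c$, where $\Delta+\Delta=\{a_1+a_2: a_1,a_2\in\Delta\}$. *)

theory Defs
  imports
    Complex_Main
    "HOL-Library.Poly_Mapping"
    "HOL-Library.Product_Plus"
    "HOL-Library.Function_Algebras"
begin

text \<open>
  The polynomial algebra in two real variables is the monoid algebra of the additive monoid of
  exponents; multiplication on the type is the convolution product.
\<close>

type_synonym mindex = "nat \<times> nat"

type_synonym bipoly = "mindex \<Rightarrow>\<^sub>0 real"

abbreviation const_poly :: "real \<Rightarrow> bipoly" where
  "const_poly c \<equiv> Poly_Mapping.single 0 c"

abbreviation xpow :: "mindex \<Rightarrow> bipoly" where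
  "xpow a \<equiv> Poly_Mapping.single a 1"

text \<open>
  The truncated subtraction below is harmless: when it truncates, the coefficient vanishes.
\<close>

definition pd1 :: "bipoly \<Rightarrow> bipoly" where
  "pd1 f = (\<Sum>m\<in>Poly_Mapping.keys f.
     Poly_Mapping.single (fst m - 1, snd m) (real (fst m) * Poly_Mapping.lookup f m))"

definition pd2 :: "bipoly \<Rightarrow> bipoly" where
  "pd2 f = (\<Sum>m\<in>Poly_Mapping.keys f.
     Poly_Mapping.single (fst m, snd m - 1) (real (snd m) * Poly_Mapping.lookup f m))"

definition pd :: "mindex \<Rightarrow> bipoly \<Rightarrow> bipoly" where
  "pd a f = (pd1 ^^ fst a) ((pd2 ^^ snd a) f)"

text \<open>
  A map of \<open>p\<close> arguments is a function on argument lists that vanishes on all lists of length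
  other than \<open>p\<close>.  With this convention equality of cochains is equality of functions, cochains
  of different arity are linearly independent, and the direct sum over all arities lives inside
  one function space, whose vector space structure is pointwise.
\<close>

type_synonym cochain = "bipoly list \<Rightarrow> bipoly"

definition cscale :: "real \<Rightarrow> cochain \<Rightarrow> cochain" where
  "cscale c \<phi> = (\<lambda>us. const_poly c * \<phi> us)"

interpretation cochain: vector_space cscale
  by unfold_locales
    (simp_all add: cscale_def fun_eq_iff algebra_simps single_add mult_single
      flip: mult.assoc)

definition diffmon :: "mindex \<Rightarrow> mindex list \<Rightarrow> cochain" where
  "diffmon a0 as = (\<lambda>us. if length us = length as
     then xpow a0 * prod_list (map2 pd as us) else 0)"

definition cochains :: "nat \<Rightarrow> cochain set" where
  "cochains p = cochain.span {diffmon a0 as | a0 as. length as = p}"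

definition int_index :: "mindex \<Rightarrow> int \<times> int" where
  "int_index a = (int (fst a), int (snd a))"

definition weight :: "mindex \<Rightarrow> mindex list \<Rightarrow> int \<times> int" where
  "weight a0 as = int_index a0 - sum_list (map int_index as)"

definition weight_space :: "int \<times> int \<Rightarrow> cochain set" where
  "weight_space a = cochain.span {diffmon a0 as | a0 as. weight a0 as = a}"

text \<open>
  The internal sum of the weight spaces with weights in \<open>D\<close>; it is direct because the
  operators \<open>diffmon a0 as\<close> are linearly independent.
\<close>

definition graded_part :: "(int \<times> int) set \<Rightarrow> cochain set" where
  "graded_part D = cochain.span (\<Union>a\<in>D. weight_space a)"

definition ideal2 :: "(int \<times> int) set \<Rightarrow> cochain set" where
  "ideal2 D = graded_part {a + b | a b. a \<in> D \<and> b \<in> D}"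

definition additive_semigroup :: "(int \<times> int) set \<Rightarrow> bool" where
  "additive_semigroup D \<longleftrightarrow> (\<forall>a\<in>D. \<forall>b\<in>D. a + b \<in> D)"

text \<open>
  Insertion of the \<open>q\<close>-ary map \<open>\<psi>\<close> into the \<open>k\<close>-th slot (counted from 1) of \<open>\<phi>\<close>.
\<close>

definition insert_at :: "nat \<Rightarrow> nat \<Rightarrow> cochain \<Rightarrow> cochain \<Rightarrow> cochain" where
  "insert_at k q \<phi> \<psi> = (\<lambda>us.
     \<phi> (take (k - 1) us @ [\<psi> (take q (drop (k - 1) us))] @ drop (k - 1 + q) us))"

text \<open>
  The arities \<open>p\<close> of \<open>\<phi>\<close> and \<open>q\<close> of \<open>\<psi>\<close> are passed explicitly.  The sign exponents
  \<open>(k - 1) (q - 1)\<close> etc. are written with \<open>+ 1\<close> in place of \<open>- 1\<close>, which preserves parity and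
  avoids truncated subtraction for arity 0.  For \<open>p = q = 0\<close> both sums are empty.
\<close>

definition gerstenhaber :: "nat \<Rightarrow> nat \<Rightarrow> cochain \<Rightarrow> cochain \<Rightarrow> cochain" where
  "gerstenhaber p q \<phi> \<psi> = (\<lambda>us. if length us = p + q - 1 then
       (\<Sum>k=1..p. (-1) ^ ((k + 1) * (q + 1)) * insert_at k q \<phi> \<psi> us)
       - (-1) ^ ((p + 1) * (q + 1)) *
         (\<Sum>k=1..q. (-1) ^ ((k + 1) * (p + 1)) * insert_at k p \<psi> \<phi> us)
     else 0)"

definition hochschild :: "nat \<Rightarrow> cochain \<Rightarrow> cochain" where
  "hochschild p \<phi> = (\<lambda>us. if length us = p + 1 then
       us ! 0 * \<phi> (drop 1 us)
       + (\<Sum>k=1..p. (-1) ^ k *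
           \<phi> (take (k - 1) us @ [us ! (k - 1) * us ! k] @ drop (k + 1) us))
       + (-1) ^ (p + 1) * \<phi> (take p us) * us ! p
     else 0)"

text \<open>
  A formal power series in \<open>t\<close> is its sequence of coefficients.
\<close>

definition hochschild_series :: "nat \<Rightarrow> (nat \<Rightarrow> cochain) \<Rightarrow> nat \<Rightarrow> cochain" where
  "hochschild_series p F = (\<lambda>m. hochschild p (F m))"

definition gerstenhaber_series ::
    "nat \<Rightarrow> nat \<Rightarrow> (nat \<Rightarrow> cochain) \<Rightarrow> (nat \<Rightarrow> cochain) \<Rightarrow> nat \<Rightarrow> cochain" where
  "gerstenhaber_series p q F G = (\<lambda>m. \<Sum>i\<le>m. gerstenhaber p q (F i) (G (m - i)))"

definition maurer_cartan :: "(nat \<Rightarrow> cochain) \<Rightarrow> bool" where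
  "maurer_cartan F \<longleftrightarrow>
     hochschild_series 2 F = (\<lambda>m. cscale (1/2) (gerstenhaber_series 2 2 F F m))"

text \<open>
  The series \<open>(t/2) \<rho> 1 + (\<Sum>k\<ge>2. t^k \<rho> k)\<close>; the value \<open>\<rho> 0\<close> is ignored.
\<close>

definition star_series :: "(nat \<Rightarrow> cochain) \<Rightarrow> nat \<Rightarrow> cochain" where
  "star_series \<rho> = (\<lambda>k. if k = 0 then 0 else if k = 1 then cscale (1/2) (\<rho> 1) else \<rho> k)"

definition poisson_bivector :: "cochain \<Rightarrow> bool" where
  "poisson_bivector \<phi> \<longleftrightarrow> \<phi> \<in> cochains 2 \<and>
     (\<exists>P. \<forall>f g. \<phi> [f, g] = P * (pd1 f * pd2 g - pd2 f * pd1 g))"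

end

theory Submission
  imports Defs "HOL-Computational_Algebra.Formal_Power_Series"
begin

text \<open>
  In dimension two every bivector \<open>P \<partial>\<^sub>1 \<and> \<partial>\<^sub>2\<close> has an explicit quantization whose \<open>n\<close>-th coefficient
  is built from \<open>n\<close> copies of \<open>P\<close>.  The weights of that coefficient therefore lie in the \<open>n\<close>-fold
  sumset of \<open>\<Delta>\<close>, which for a semigroup and \<open>n \<ge> 2\<close> is contained in \<open>\<Delta> + \<Delta>\<close>.  This bypasses the
  Hochschild-Kostant-Rosenberg computation of the obstruction space.

  The quantization is the algebra with two generators and the single relation
  \<open>y x = x y - t P(x, y)\<close>, in which \<open>P\<close> is written with all \<open>x\<close> to the left.  With only one
  rewriting rule there is no overlap to resolve, so the ordered monomials \<open>x\<^sup>i y\<^sup>j\<close> stay a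
  topological basis and carry an associative product.  Concretely, \<open>x\<close> acts on polynomials by
  multiplication and \<open>y\<close> acts by \<open>Y = y + U\<close>, where \<open>U = t U\<^sub>1 + t\<^sup>2 U\<^sub>2 + \<dots>\<close>
  consists of differential operators in \<open>x\<close> alone.  The relation reads \<open>[U, x] = - t P(x, Y)\<close> and
  determines \<open>U\<close> recursively, since a commutator with \<open>x\<close> differentiates a symbol in the dual
  variable of \<open>x\<close> and can be integrated (\<open>diffop_x_integrate\<close>, \<open>normal_ordering_exists\<close>).  As \<open>y\<close>
  commutes with \<open>U\<close>, Taylor expansion gives \<open>f(x, Y) = (\<Sum>m. (\<partial>\<^sub>2\<^sup>m f / m!) U\<^sup>m)\<close>, so
  \<open>f \<star> g = f(x, Y) g\<close> has bidifferential coefficients; a \<open>t\<close>-adic induction shows that it is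
  associative (\<open>star_nord\<close>).

  Its first-order term \<open>- P \<partial>\<^sub>2 f \<partial>\<^sub>1 g\<close> is not antisymmetric.  Conjugation by
  \<open>1 + (t/2) P \<partial>\<^sub>1 \<partial>\<^sub>2\<close> preserves associativity (\<open>gauge_star\<close>) and weights, and turns it into
  \<open>(1/2) P (\<partial>\<^sub>1 f \<partial>\<^sub>2 g - \<partial>\<^sub>2 f \<partial>\<^sub>1 g)\<close> (\<open>star_product_exists\<close>).  Associativity is the
  Maurer-Cartan equation (\<open>maurer_cartan_star\<close>).  Finally, evaluating the given bivector at the pair
  of coordinates recovers \<open>P\<close>, so that the hypothesis on weights bounds the monomials of \<open>P\<close>
  (\<open>keys_bivector_of_graded_part\<close>).
\<close>

section \<open>Polynomials in two variables and their derivatives\<close>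

lemma bipoly_sum_monomials:
  fixes f :: bipoly
  shows "f = (\<Sum>m\<in>Poly_Mapping.keys f. Poly_Mapping.single m (Poly_Mapping.lookup f m))"
proof (rule poly_mapping_eqI)
  fix k
  have "(\<Sum>m\<in>Poly_Mapping.keys f. Poly_Mapping.lookup (Poly_Mapping.single m (Poly_Mapping.lookup f m)) k)
      = (\<Sum>m\<in>Poly_Mapping.keys f. if k = m then Poly_Mapping.lookup f m else 0)"
    by (rule sum.cong) (auto simp: lookup_single when_def)
  also have "\<dots> = Poly_Mapping.lookup f k"
    by (simp add: in_keys_iff)
  finally show "Poly_Mapping.lookup f k = Poly_Mapping.lookup
      (\<Sum>m\<in>Poly_Mapping.keys f. Poly_Mapping.single m (Poly_Mapping.lookup f m)) k"
    by (simp add: lookup_sum)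
qed

lemma bipoly_induct_add [case_names zero single add]:
  fixes f :: bipoly
  assumes "Q 0" and "\<And>m c. Q (Poly_Mapping.single m c)" and "\<And>f g. Q f \<Longrightarrow> Q g \<Longrightarrow> Q (f + g)"
  shows "Q f"
proof -
  have "Q (\<Sum>m\<in>S. Poly_Mapping.single m (Poly_Mapping.lookup f m))" if "finite S" for S
    using that by (induction S rule: finite_induct) (use assms in auto)
  then show ?thesis
    using bipoly_sum_monomials[of f] by (metis finite_keys)
qed

text \<open>
  Definitions rather than abbreviations, so that simplification does not turn the exponent \<open>1\<close>
  into a successor and lose sight of the coordinates.
\<close>

definition varx :: bipoly where "varx = xpow (1, 0)"
definition vary :: bipoly where "vary = xpow (0, 1)"

lemma xpow_Suc: "xpow (Suc i, j) = varx * xpow (i, j)" "xpow (i, Suc j) = vary * xpow (i, j)"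
  by (simp_all add: varx_def vary_def mult_single)

lemma single_eq_xpow: "Poly_Mapping.single m c = const_poly c * xpow m"
  by (simp add: mult_single)

lemma bipoly_induct [case_names one varx vary scale add]:
  fixes f :: bipoly
  assumes one: "Q 1" and varx: "\<And>f. Q f \<Longrightarrow> Q (varx * f)" and vary: "\<And>f. Q f \<Longrightarrow> Q (vary * f)"
    and scale: "\<And>c f. Q f \<Longrightarrow> Q (const_poly c * f)" and add: "\<And>f g. Q f \<Longrightarrow> Q g \<Longrightarrow> Q (f + g)"
  shows "Q f"
proof (induction f rule: bipoly_induct_add)
  case zero
  show ?case using scale[OF one, of 0] by simp
next
  case (single m c)
  have y: "Q (xpow (0, j))" for j
  proof (induction j)
    case 0
    then show ?case using one by (simp add: single_one flip: zero_prod_def)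
  next
    case (Suc j)
    show ?case unfolding xpow_Suc by (rule vary[OF Suc])
  qed
  have "Q (xpow (i, j))" for i j
  proof (induction i)
    case (Suc i)
    show ?case unfolding xpow_Suc by (rule varx[OF Suc])
  qed (rule y)
  then show ?case
    using scale by (metis prod.exhaust single_eq_xpow)
next
  case (add f g)
  then show ?case by (rule assms)
qed

lemma lookup_pd1: "Poly_Mapping.lookup (pd1 f) (i, j) = real (Suc i) * Poly_Mapping.lookup f (Suc i, j)"
proof -
  have "Poly_Mapping.lookup (pd1 f) (i, j) = (\<Sum>m\<in>Poly_Mapping.keys f.
     if m = (Suc i, j) then real (fst m) * Poly_Mapping.lookup f m else 0)"
    unfolding pd1_def lookup_sum
    by (rule sum.cong) (auto simp: lookup_single when_def)
  then show ?thesis by (simp add: in_keys_iff)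
qed

lemma lookup_pd2: "Poly_Mapping.lookup (pd2 f) (i, j) = real (Suc j) * Poly_Mapping.lookup f (i, Suc j)"
proof -
  have "Poly_Mapping.lookup (pd2 f) (i, j) = (\<Sum>m\<in>Poly_Mapping.keys f.
     if m = (i, Suc j) then real (snd m) * Poly_Mapping.lookup f m else 0)"
    unfolding pd2_def lookup_sum
    by (rule sum.cong) (auto simp: lookup_single when_def)
  then show ?thesis by (simp add: in_keys_iff)
qed

lemma pd1_add: "pd1 (f + g) = pd1 f + pd1 g"
  by (rule poly_mapping_eqI) (auto simp: lookup_pd1 lookup_add algebra_simps)

lemma pd2_add: "pd2 (f + g) = pd2 f + pd2 g"
  by (rule poly_mapping_eqI) (auto simp: lookup_pd2 lookup_add algebra_simps)

lemma pd1_single: "pd1 (Poly_Mapping.single m c) =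
    Poly_Mapping.single (fst m - 1, snd m) (real (fst m) * c)"
  by (simp add: pd1_def)

lemma pd2_single: "pd2 (Poly_Mapping.single m c) =
    Poly_Mapping.single (fst m, snd m - 1) (real (snd m) * c)"
  by (simp add: pd2_def)

lemma pd1_mult: "pd1 (f * g) = pd1 f * g + f * pd1 g"
proof (induction f rule: bipoly_induct_add)
  case zero
  show ?case by (simp add: pd1_def)
next
  case (single m c)
  show ?case
  proof (induction g rule: bipoly_induct_add)
    case zero
    show ?case by (simp add: pd1_def)
  next
    case (single n d)
    obtain i j k l where [simp]: "m = (i, j)" "n = (k, l)" by (cases m, cases n)
    show ?case
      by (cases i; cases k) (simp_all add: pd1_single mult_single algebra_simps flip: single_add)
  next
    case (add f g)
    then show ?case by (simp add: pd1_add algebra_simps)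
  qed
next
  case (add f g)
  then show ?case by (simp add: pd1_add algebra_simps)
qed

lemma pd2_mult: "pd2 (f * g) = pd2 f * g + f * pd2 g"
proof (induction f rule: bipoly_induct_add)
  case zero
  show ?case by (simp add: pd2_def)
next
  case (single m c)
  show ?case
  proof (induction g rule: bipoly_induct_add)
    case zero
    show ?case by (simp add: pd2_def)
  next
    case (single n d)
    obtain i j k l where [simp]: "m = (i, j)" "n = (k, l)" by (cases m, cases n)
    show ?case
      by (cases j; cases l) (simp_all add: pd2_single mult_single algebra_simps flip: single_add)
  next
    case (add f g)
    then show ?case by (simp add: pd2_add algebra_simps)
  qed
next
  case (add f g)
  then show ?case by (simp add: pd2_add algebra_simps)
qed

lemma pd1_pd2_commute: "pd1 (pd2 f) = pd2 (pd1 f)"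
  by (rule poly_mapping_eqI) (auto simp: lookup_pd1 lookup_pd2)

lemma pd1_const [simp]: "pd1 (const_poly c) = 0"
  by (simp add: pd1_single)

lemma pd2_const [simp]: "pd2 (const_poly c) = 0"
  by (simp add: pd2_single)

lemma pd_var [simp]: "pd1 varx = 1" "pd2 varx = 0" "pd1 vary = 0" "pd2 vary = 1"
  by (simp_all add: varx_def vary_def pd1_single pd2_single flip: zero_prod_def)

section \<open>The ring of linear operators on polynomials\<close>

text \<open>
  A type of its own, because composition makes these operators a noncommutative ring and formal
  power series over that ring then come with their associative product for free.
\<close>

typedef lop = "{D :: bipoly \<Rightarrow> bipoly. (\<forall>f g. D (f + g) = D f + D g) \<and>
    (\<forall>c f. D (const_poly c * f) = const_poly c * D f)}"
  morphisms app Lop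
  by (rule exI[of _ id]) simp

setup_lifting type_definition_lop

lemma app_add: "app D (f + g) = app D f + app D g"
  using app[of D] by simp

lemma app_scale: "app D (const_poly c * f) = const_poly c * app D f"
  using app[of D] by simp

lemma app_zero [simp]: "app D 0 = 0"
  using app_scale[of D 0 0] by simp

instantiation lop :: ring_1
begin

lift_definition zero_lop :: lop is "\<lambda>_. 0" by simp
lift_definition one_lop :: lop is "\<lambda>f. f" by simp
lift_definition plus_lop :: "lop \<Rightarrow> lop \<Rightarrow> lop" is "\<lambda>D E f. D f + E f"
  by (simp add: algebra_simps)
lift_definition minus_lop :: "lop \<Rightarrow> lop \<Rightarrow> lop" is "\<lambda>D E f. D f - E f"
  by (simp add: algebra_simps)
lift_definition uminus_lop :: "lop \<Rightarrow> lop" is "\<lambda>D f. - D f"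
  by (simp add: algebra_simps)
lift_definition times_lop :: "lop \<Rightarrow> lop \<Rightarrow> lop" is "\<lambda>D E f. D (E f)"
  by simp

instance
proof
  show "(0::lop) \<noteq> 1"
    by transfer (metis zero_neq_one)
qed (transfer; simp add: fun_eq_iff algebra_simps)+

end

lemma app_ring_simps [simp]:
  "app 0 f = 0" "app 1 f = f" "app (D + E) f = app D f + app E f" "app (D - E) f = app D f - app E f"
  "app (- D) f = - app D f" "app (D * E) f = app D (app E f)"
  by (transfer; simp)+

lemma lop_eqI: "(\<And>f. app D f = app E f) \<Longrightarrow> D = E"
  by transfer auto

lemma app_sum_left: "app (sum D S) f = (\<Sum>s\<in>S. app (D s) f)"
  by (induction S rule: infinite_finite_induct) auto

definition mul :: "bipoly \<Rightarrow> lop" where "mul f = Lop (\<lambda>g. f * g)"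
definition dx :: lop where "dx = Lop pd1"
definition dy :: lop where "dy = Lop pd2"

lemma app_mul [simp]: "app (mul f) g = f * g"
  by (simp add: mul_def Lop_inverse algebra_simps)
lemma app_dx [simp]: "app dx f = pd1 f"
  by (simp add: dx_def Lop_inverse pd1_add pd1_mult)
lemma app_dy [simp]: "app dy f = pd2 f"
  by (simp add: dy_def Lop_inverse pd2_add pd2_mult)

lemma mul_add: "mul (f + g) = mul f + mul g"
  and mul_mult: "mul (f * g) = mul f * mul g"
  and mul_0 [simp]: "mul 0 = 0" and mul_1 [simp]: "mul 1 = 1"
  by (rule lop_eqI; simp add: algebra_simps)+

lemma mul_commute: "mul f * mul g = mul g * mul f"
  by (simp add: mult.commute flip: mul_mult)

lemma dx_mul: "dx * mul f = mul f * dx + mul (pd1 f)"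
  by (rule lop_eqI) (simp add: pd1_mult algebra_simps)

lemma dy_mul: "dy * mul f = mul f * dy + mul (pd2 f)"
  by (rule lop_eqI) (simp add: pd2_mult algebra_simps)

lemma dy_dx: "dy * dx = dx * dy"
  by (rule lop_eqI) (simp add: pd1_pd2_commute)

lemma dy_dx_power: "dy * dx ^ i = dx ^ i * dy"
proof (induction i)
  case (Suc i)
  have "dy * dx ^ Suc i = dx * (dy * dx ^ i)"
    by (simp add: dy_dx flip: mult.assoc)
  then show ?case by (simp add: Suc mult.assoc)
qed simp

lemma scalar_commute: "D * mul (const_poly c) = mul (const_poly c) * D"
  by (rule lop_eqI) (simp add: app_scale)

section \<open>Differential operators and their weights\<close>

text \<open>
  \<open>J\<close> restricts the orders of differentiation in the second variable.  The two relevant cases are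
  \<open>{0}\<close>, the operators that differentiate in the first variable only, and \<open>UNIV\<close>, the full Weyl
  algebra; both are closed under composition.  Normal-ordered monomials as generators make this
  family the span of the weight vectors with weight in \<open>V\<close>.
\<close>

inductive_set diffop :: "nat set \<Rightarrow> (int \<times> int) set \<Rightarrow> lop set" for J V where
  zero: "0 \<in> diffop J V"
| add: "D \<in> diffop J V \<Longrightarrow> E \<in> diffop J V \<Longrightarrow> D + E \<in> diffop J V"
| mon: "j \<in> J \<Longrightarrow> int_index a - (int i, int j) \<in> V \<Longrightarrow>
    mul (Poly_Mapping.single a c) * dx ^ i * dy ^ j \<in> diffop J V"

lemma diffop_mono: "D \<in> diffop J V \<Longrightarrow> J \<subseteq> J' \<Longrightarrow> V \<subseteq> V' \<Longrightarrow> D \<in> diffop J' V'"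
  by (induction rule: diffop.induct) (auto intro: diffop.intros)

lemma diffop_sum: "(\<And>s. s \<in> S \<Longrightarrow> D s \<in> diffop J V) \<Longrightarrow> sum D S \<in> diffop J V"
  by (induction S rule: infinite_finite_induct) (auto intro: diffop.intros)

lemma diffop_mul:
  assumes "\<And>a. a \<in> Poly_Mapping.keys f \<Longrightarrow> int_index a \<in> V" and "0 \<in> J"
  shows "mul f \<in> diffop J V"
proof -
  have "mul (\<Sum>m\<in>S. Poly_Mapping.single m (Poly_Mapping.lookup f m)) \<in> diffop J V"
    if "finite S" "S \<subseteq> Poly_Mapping.keys f" for S
    using that
  proof (induction S rule: finite_induct)
    case empty
    then show ?case by (simp add: diffop.zero)
  next
    case (insert m S)
    then have "mul (Poly_Mapping.single m (Poly_Mapping.lookup f m)) * dx ^ 0 * dy ^ 0 \<in> diffop J V"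
      using assms by (intro diffop.mon) (auto simp flip: zero_prod_def)
    then show ?case using insert by (auto simp: mul_add intro: diffop.add)
  qed
  then show ?thesis
    using bipoly_sum_monomials[of f] by (metis finite_keys order_refl)
qed

lemma diffop_one: "0 \<in> V \<Longrightarrow> 0 \<in> J \<Longrightarrow> 1 \<in> diffop J V"
  using diffop_mul[of 1 V J] by (simp add: int_index_def flip: zero_prod_def)

lemma diffop_single_mult:
  assumes "D \<in> diffop J V"
  shows "mul (Poly_Mapping.single b d) * D \<in> diffop J ((+) (int_index b) ` V)"
  using assms
proof (induction rule: diffop.induct)
  case zero
  then show ?case by (simp add: diffop.zero)
next
  case (add D E)
  then show ?case by (simp add: distrib_left diffop.add)
next
  case (mon j a i c)
  have "int_index (b + a) - (int i, int j) \<in> (+) (int_index b) ` V"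
    using mon by (auto simp: int_index_def image_iff intro!: bexI[OF _ mon(2)])
  then have "mul (Poly_Mapping.single (b + a) (d * c)) * dx ^ i * dy ^ j \<in> diffop J ((+) (int_index b) ` V)"
    by (rule diffop.mon[OF mon(1)])
  then show ?case by (simp add: mult.assoc mul_mult flip: mult_single)
qed

lemma diffop_dx_mult:
  assumes "D \<in> diffop J V"
  shows "dx * D \<in> diffop J ((+) (-1, 0) ` V)"
  using assms
proof (induction rule: diffop.induct)
  case zero
  then show ?case by (simp add: diffop.zero)
next
  case (add D E)
  then show ?case by (simp add: distrib_left diffop.add)
next
  case (mon j a i c)
  have 1: "mul (Poly_Mapping.single a c) * dx ^ Suc i * dy ^ j \<in> diffop J ((+) (-1, 0) ` V)"
    using mon by (intro diffop.mon) (auto simp: int_index_def image_iff intro!: bexI[OF _ mon(2)])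
  have 2: "mul (pd1 (Poly_Mapping.single a c)) * dx ^ i * dy ^ j \<in> diffop J ((+) (-1, 0) ` V)"
  proof (cases "fst a = 0")
    case False
    then show ?thesis
      using mon unfolding pd1_single
      by (intro diffop.mon) (auto simp: int_index_def image_iff intro!: bexI[OF _ mon(2)])
  qed (simp add: pd1_single diffop.zero)
  have "dx * (mul (Poly_Mapping.single a c) * dx ^ i * dy ^ j) =
      (dx * mul (Poly_Mapping.single a c)) * dx ^ i * dy ^ j"
    by (simp add: mult.assoc)
  also have "\<dots> = mul (Poly_Mapping.single a c) * dx ^ Suc i * dy ^ j
      + mul (pd1 (Poly_Mapping.single a c)) * dx ^ i * dy ^ j"
    unfolding dx_mul by (simp add: distrib_right mult.assoc)
  finally show ?case using diffop.add[OF 1 2] by simp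
qed

lemma diffop_dy_mult:
  assumes "D \<in> diffop UNIV V"
  shows "dy * D \<in> diffop UNIV ((+) (0, -1) ` V)"
  using assms
proof (induction rule: diffop.induct)
  case zero
  then show ?case by (simp add: diffop.zero)
next
  case (add D E)
  then show ?case by (simp add: distrib_left diffop.add)
next
  case (mon j a i c)
  have 1: "mul (Poly_Mapping.single a c) * dx ^ i * dy ^ Suc j \<in> diffop UNIV ((+) (0, -1) ` V)"
    using mon by (intro diffop.mon) (auto simp: int_index_def image_iff intro!: bexI[OF _ mon(2)])
  have 2: "mul (pd2 (Poly_Mapping.single a c)) * dx ^ i * dy ^ j \<in> diffop UNIV ((+) (0, -1) ` V)"
  proof (cases "snd a = 0")
    case False
    then show ?thesis
      using mon unfolding pd2_single
      by (intro diffop.mon) (auto simp: int_index_def image_iff intro!: bexI[OF _ mon(2)])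
  qed (simp add: pd2_single diffop.zero)
  have "dy * (mul (Poly_Mapping.single a c) * dx ^ i * dy ^ j) =
      (dy * mul (Poly_Mapping.single a c)) * dx ^ i * dy ^ j"
    by (simp add: mult.assoc)
  also have "\<dots> = mul (Poly_Mapping.single a c) * (dy * dx ^ i) * dy ^ j
      + mul (pd2 (Poly_Mapping.single a c)) * dx ^ i * dy ^ j"
    unfolding dy_mul by (simp add: distrib_right mult.assoc)
  also have "\<dots> = mul (Poly_Mapping.single a c) * dx ^ i * dy ^ Suc j
      + mul (pd2 (Poly_Mapping.single a c)) * dx ^ i * dy ^ j"
    by (simp add: dy_dx_power mult.assoc)
  finally show ?case using diffop.add[OF 1 2] by simp
qed

lemma diffop_dx_power_mult:
  assumes "D \<in> diffop J V"
  shows "dx ^ i * D \<in> diffop J ((+) (- int i, 0) ` V)"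
proof (induction i)
  case 0
  then show ?case using assms by (auto simp flip: zero_prod_def)
next
  case (Suc i)
  have "dx * (dx ^ i * D) \<in> diffop J ((+) (-1, 0) ` ((+) (- int i, 0) ` V))"
    using Suc by (rule diffop_dx_mult)
  moreover have "(+) (-1, 0) ` ((+) (- int i, 0) ` V) = (+) (- int (Suc i), 0) ` V"
    by (simp add: image_comp comp_def flip: add.assoc)
  ultimately show ?case by (simp add: mult.assoc)
qed

lemma diffop_dy_power_mult:
  assumes "D \<in> diffop UNIV V"
  shows "dy ^ i * D \<in> diffop UNIV ((+) (0, - int i) ` V)"
proof (induction i)
  case 0
  then show ?case using assms by (auto simp flip: zero_prod_def)
next
  case (Suc i)
  have "dy * (dy ^ i * D) \<in> diffop UNIV ((+) (0, -1) ` ((+) (0, - int i) ` V))"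
    using Suc by (rule diffop_dy_mult)
  moreover have "(+) (0, -1) ` ((+) (0, - int i) ` V) = (+) (0, - int (Suc i)) ` V"
    by (simp add: image_comp comp_def flip: add.assoc)
  ultimately show ?case by (simp add: mult.assoc)
qed

text \<open>
  Moving derivatives past a coefficient by the Leibniz rule does not change the total weight, so
  weights add under composition.
\<close>

lemma diffop_mult:
  assumes "D \<in> diffop J V" and E: "E \<in> diffop J V'" and J: "J = {0} \<or> J = UNIV"
    and V: "\<And>v w. v \<in> V \<Longrightarrow> w \<in> V' \<Longrightarrow> v + w \<in> V''"
  shows "D * E \<in> diffop J V''"
  using assms(1)
proof (induction rule: diffop.induct)
  case zero
  then show ?case by (simp add: diffop.zero)
next
  case (add D E)
  then show ?case by (simp add: distrib_right diffop.add)
next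
  case (mon j a i c)
  have "dy ^ j * E \<in> diffop J ((+) (0, - int j) ` V')"
    using J
  proof
    assume "J = {0}"
    then show ?thesis using mon E by (auto simp flip: zero_prod_def)
  next
    assume "J = UNIV"
    then show ?thesis using diffop_dy_power_mult E by blast
  qed
  from diffop_single_mult[OF diffop_dx_power_mult[OF this]]
  have "mul (Poly_Mapping.single a c) * (dx ^ i * (dy ^ j * E)) \<in>
      diffop J ((+) (int_index a) ` (+) (- int i, 0) ` (+) (0, - int j) ` V')" .
  moreover have "int_index a + ((- int i, 0) + ((0, - int j) + w)) \<in> V''" if "w \<in> V'" for w
  proof -
    have "int_index a + ((- int i, 0) + ((0, - int j) + w)) = int_index a - (int i, int j) + w"
      by (cases w) (simp add: int_index_def)
    then show ?thesis using V[OF mon(2) that] by (simp only:)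
  qed
  then have "(+) (int_index a) ` (+) (- int i, 0) ` (+) (0, - int j) ` V' \<subseteq> V''"
    by blast
  ultimately show ?case
    by (simp add: mult.assoc) (blast intro: diffop_mono)
qed

lemma diffop_x_commute_vary:
  "D \<in> diffop {0} V \<Longrightarrow> D * mul vary = mul vary * D"
proof (induction rule: diffop.induct)
  case (mon j a i c)
  have "dx * mul vary = mul vary * dx"
    by (simp add: dx_mul)
  then have "dx ^ i * mul vary = mul vary * dx ^ i"
    by (induction i) (simp_all add: mult.assoc, simp flip: mult.assoc)
  then have "mul (Poly_Mapping.single a c) * (dx ^ i * mul vary) = mul (Poly_Mapping.single a c) * mul vary * dx ^ i"
    by (simp add: mult.assoc)
  then show ?case using mon by (simp add: mult.assoc) (simp add: mul_commute flip: mult.assoc)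
qed (simp_all add: algebra_simps)

lemma dx_power_varx:
  "dx ^ Suc i * mul varx = mul varx * dx ^ Suc i + mul (const_poly (real (Suc i))) * dx ^ i"
proof (induction i)
  case 0
  show ?case by (simp add: dx_mul)
next
  case (Suc i)
  have "dx ^ Suc (Suc i) * mul varx = dx * (mul varx * dx ^ Suc i + mul (const_poly (real (Suc i))) * dx ^ i)"
    using Suc by (simp add: mult.assoc)
  also have "\<dots> = (dx * mul varx) * dx ^ Suc i + (dx * mul (const_poly (real (Suc i)))) * dx ^ i"
    by (simp add: algebra_simps)
  also have "\<dots> = mul varx * dx ^ Suc (Suc i) + (1 + mul (const_poly (real (Suc i)))) * dx ^ Suc i"
    unfolding scalar_commute by (simp add: dx_mul algebra_simps)
  also have "1 + mul (const_poly (real (Suc i))) = mul (const_poly (real (Suc (Suc i))))"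
    by (simp flip: mul_1 mul_add single_one single_add)
  finally show ?case .
qed

text \<open>
  Commutation with \<open>x\<close> acts on the monomial \<open>x\<^sup>a \<partial>\<^sub>1\<^sup>i\<^sup>+\<^sup>1\<close> as \<open>d/d\<partial>\<^sub>1\<close>, hence is
  inverted by integration in the symbol \<open>\<partial>\<^sub>1\<close>.  The primitive without constant term is the one that
  annihilates the constants.
\<close>

lemma diffop_x_integrate:
  assumes "D \<in> diffop {0} V" "\<And>v. v \<in> V \<Longrightarrow> v - (1, 0) \<in> V'"
  shows "\<exists>R\<in>diffop {0} V'. R * mul varx = mul varx * R + D \<and> app R 1 = 0"
  using assms(1)
proof (induction rule: diffop.induct)
  case zero
  show ?case by (intro bexI[of _ 0]) (auto intro: diffop.zero)
next
  case (add D E)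
  then obtain R R' where "R \<in> diffop {0} V'" "R' \<in> diffop {0} V'"
    "R * mul varx = mul varx * R + D" "R' * mul varx = mul varx * R' + E" "app R 1 = 0" "app R' 1 = 0"
    by blast
  then show ?case
    by (intro bexI[of _ "R + R'"]) (auto simp: algebra_simps intro: diffop.add)
next
  case (mon j a i c)
  define R where "R = mul (Poly_Mapping.single a (c / real (Suc i))) * dx ^ Suc i"
  have "int_index a - (int (Suc i), int 0) \<in> V'"
    using assms(2)[OF mon(2)] mon(1) by (simp add: int_index_def algebra_simps)
  from diffop.mon[OF _ this, of "{0}"] have 1: "R \<in> diffop {0} V'"
    by (simp add: R_def)
  have "R * mul varx = mul (Poly_Mapping.single a (c / real (Suc i))) * (dx ^ Suc i * mul varx)"
    by (simp add: R_def mult.assoc)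
  also have "\<dots> = mul varx * R + mul (Poly_Mapping.single a (c / real (Suc i)) * const_poly (real (Suc i))) * dx ^ i"
    unfolding dx_power_varx by (simp add: R_def distrib_left mul_commute mul_mult flip: mult.assoc)
  also have "Poly_Mapping.single a (c / real (Suc i)) * const_poly (real (Suc i)) = Poly_Mapping.single a c"
    by (simp add: mult_single)
  finally have 2: "R * mul varx = mul varx * R + mul (Poly_Mapping.single a c) * dx ^ i" .
  have "app (dx ^ Suc i) 1 = 0"
    by (induction i) (use pd1_const[of 1] pd1_const[of 0] in \<open>simp_all add: single_one\<close>)
  then have "app R 1 = 0"
    by (simp add: R_def del: power_Suc)
  with 1 2 mon(1) show ?case by (intro bexI[of _ R]) auto
qed

section \<open>Associative products as operator-valued series\<close>

unbundle fps_syntax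

text \<open>
  A map \<open>K\<close> from polynomials to operator series extends \<open>t\<close>-linearly to power series of polynomials;
  \<open>ext K U g\<close> is the value of that extension at the series \<open>U g\<close>.
\<close>

definition ext :: "(bipoly \<Rightarrow> lop fps) \<Rightarrow> lop fps \<Rightarrow> bipoly \<Rightarrow> lop fps" where
  "ext K U g = Abs_fps (\<lambda>n. \<Sum>i=0..n. K (app (U $ i) g) $ (n - i))"

lemma ext_nth: "ext K U g $ n = (\<Sum>i=0..n. K (app (U $ i) g) $ (n - i))"
  by (simp add: ext_def)

definition additive_map :: "(bipoly \<Rightarrow> lop fps) \<Rightarrow> bool" where
  "additive_map K \<longleftrightarrow> (\<forall>f g. K (f + g) = K f + K g)"

text \<open>
  \<open>K f\<close> is to be read as left multiplication by \<open>f\<close>.  For the product \<open>f \<star> g = K f g\<close> the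
  condition says that multiplying by \<open>g\<close> and then by \<open>f\<close> is multiplying by \<open>f \<star> g\<close>,
  that is, associativity.
\<close>

definition star :: "(bipoly \<Rightarrow> lop fps) \<Rightarrow> bool" where
  "star K \<longleftrightarrow> (\<forall>f g. K f * K g = ext K (K f) g)"

lemma additive_zero: "additive_map K \<Longrightarrow> K 0 = 0"
  unfolding additive_map_def by (metis add_cancel_right_right)

lemma additive_sum: "additive_map K \<Longrightarrow> K (sum f S) = (\<Sum>s\<in>S. K (f s))"
  by (induction S rule: infinite_finite_induct) (auto simp: additive_zero additive_map_def)

lemma sum_triangle_swap:
  fixes h :: "nat \<Rightarrow> nat \<Rightarrow> 'a::comm_monoid_add"
  shows "(\<Sum>i=0..n. \<Sum>j=0..n-i. h i j) = (\<Sum>j=0..n. \<Sum>i=0..n-j. h i j)"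
proof -
  have "{0..n-i} = {j\<in>{0..n}. i + j \<le> n}" "{0..n-i} = {j\<in>{0..n}. j + i \<le> n}" if "i \<in> {0..n}" for i
    using that by auto
  then show ?thesis
    using sum.swap_restrict[of "{0..n}" "{0..n}" h "\<lambda>i j. i + j \<le> n"] by simp
qed

text \<open>
  The laws of \<open>ext\<close> compare triple sums over the same indices, grouped in different orders as in
  the associativity of the Cauchy product.
\<close>

lemma ext_ext:
  assumes "additive_map K"
  shows "ext (\<lambda>h. ext K S h) U g = ext K (S * U) g"
proof (rule fps_ext)
  fix n
  let ?f = "\<lambda>j i k. K (app (S $ j) (app (U $ i) g)) $ k"
  have "ext K (S * U) g $ n = (\<Sum>l=0..n. \<Sum>j=0..l. ?f j (l - j) (n - l))"
    by (simp add: ext_nth fps_mult_nth app_sum_left additive_sum[OF assms] fps_sum_nth)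
  also have "\<dots> = (\<Sum>j=0..n. \<Sum>i=0..n-j. ?f j i (n - j - i))"
    by (rule fps_mult_assoc_lemma)
  also have "\<dots> = (\<Sum>i=0..n. \<Sum>j=0..n-i. ?f j i (n - j - i))"
    by (rule sum_triangle_swap)
  finally show "ext (\<lambda>h. ext K S h) U g $ n = ext K (S * U) g $ n"
    by (simp add: ext_nth diff_diff_left add.commute)
qed

lemma ext_mult_left: "ext (\<lambda>h. T * K h) U g = T * ext K U g"
proof (rule fps_ext)
  fix n
  have "ext (\<lambda>h. T * K h) U g $ n = (\<Sum>i=0..n. \<Sum>j=0..n-i. T $ j * K (app (U $ i) g) $ (n - i - j))"
    by (simp add: ext_nth fps_mult_nth)
  also have "\<dots> = (\<Sum>j=0..n. \<Sum>i=0..n-j. T $ j * K (app (U $ i) g) $ (n - i - j))"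
    by (rule sum_triangle_swap)
  finally show "ext (\<lambda>h. T * K h) U g $ n = (T * ext K U g) $ n"
    by (simp add: ext_nth fps_mult_nth sum_distrib_left diff_diff_left add.commute)
qed

lemma ext_mult_right: "ext (\<lambda>h. K h * S) U g = ext K U g * S"
proof (rule fps_ext)
  fix n
  have "(ext K U g * S) $ n = (\<Sum>l=0..n. \<Sum>i=0..l. K (app (U $ i) g) $ (l - i) * S $ (n - l))"
    by (simp add: ext_nth fps_mult_nth sum_distrib_right)
  also have "\<dots> = (\<Sum>i=0..n. \<Sum>j=0..n-i. K (app (U $ i) g) $ j * S $ (n - i - j))"
    by (rule fps_mult_assoc_lemma)
  finally show "ext (\<lambda>h. K h * S) U g $ n = (ext K U g * S) $ n"
    by (simp add: ext_nth fps_mult_nth)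
qed

lemma ext_comp:
  assumes "additive_map K"
  shows "ext (\<lambda>h. ext K (M h) g) S f = ext K (ext M S f) g"
proof (rule fps_ext)
  fix n
  let ?f = "\<lambda>i j k. K (app (M (app (S $ i) f) $ j) g) $ k"
  have "ext K (ext M S f) g $ n = (\<Sum>l=0..n. \<Sum>i=0..l. ?f i (l - i) (n - l))"
    by (simp add: ext_nth app_sum_left additive_sum[OF assms] fps_sum_nth)
  also have "\<dots> = (\<Sum>i=0..n. \<Sum>j=0..n-i. ?f i j (n - i - j))"
    by (rule fps_mult_assoc_lemma)
  finally show "ext (\<lambda>h. ext K (M h) g) S f $ n = ext K (ext M S f) g $ n"
    by (simp add: ext_nth)
qed

lemma ext_add: "additive_map K \<Longrightarrow> ext K (S + T) g = ext K S g + ext K T g"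
  by (rule fps_ext) (simp add: ext_nth additive_map_def sum.distrib)

lemma ext_const_left:
  assumes "additive_map K" and "\<And>h. K (f * h) = fps_const (mul f) * K h"
  shows "ext K (fps_const (mul f) * S) g = fps_const (mul f) * ext K S g"
  by (rule fps_ext) (simp add: ext_nth assms sum_distrib_left)

lemma ext_const_right: "ext K (S * fps_const (mul f)) g = ext K S (f * g)"
  by (rule fps_ext) (simp add: ext_nth)

lemma ext_one: "additive_map K \<Longrightarrow> ext K 1 g = K g"
  by (rule fps_ext) (auto simp: ext_nth additive_zero sum.atLeast_Suc_atMost[of 0] intro!: sum.neutral)

lemma ext_X: "additive_map K \<Longrightarrow> ext K (fps_X * S) g = fps_X * ext K S g"
proof (rule fps_ext)
  fix n assume "additive_map K"
  then show "ext K (fps_X * S) g $ n = (fps_X * ext K S g) $ n"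
    by (cases n) (simp_all add: ext_nth additive_zero sum.atLeast0_atMost_Suc_shift del: sum.cl_ivl_Suc)
qed

text \<open>
  Congruence modulo \<open>t\<^sup>n\<close>.
\<close>

definition agree :: "nat \<Rightarrow> 'a::zero fps \<Rightarrow> 'a fps \<Rightarrow> bool" where
  "agree n F G \<longleftrightarrow> (\<forall>k<n. F $ k = G $ k)"

lemma agree_refl [simp]: "agree n F F"
  and agree_trans [trans]: "agree n F G \<Longrightarrow> agree n G H \<Longrightarrow> agree n F H"
  by (simp_all add: agree_def)

lemma agree_add: "agree n F F' \<Longrightarrow> agree n G G' \<Longrightarrow> agree n (F + G) (F' + G')"
  for F :: "lop fps"
  by (simp add: agree_def)

lemma agree_mult_left: "agree n G G' \<Longrightarrow> agree n (F * G) (F * G')"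
  for F :: "lop fps"
  by (auto simp: agree_def fps_mult_nth intro!: sum.cong)

lemma agree_X: "agree n F G \<Longrightarrow> agree (Suc n) (fps_X * F) (fps_X * G)"
  for F :: "lop fps"
  by (auto simp: agree_def)

lemma agree_ext: "(\<And>h. agree n (K h) (K' h)) \<Longrightarrow> agree n (ext K U g) (ext K' U g)"
  by (auto simp: agree_def ext_nth intro!: sum.cong)

text \<open>
  Modulo \<open>t\<^sup>n\<close>, composition with \<open>S\<close> on the left sends left multiplication by \<open>g\<close> to left
  multiplication by \<open>S g\<close>.  Such \<open>S\<close> form a subring, so that associativity has to be checked on
  generators only.
\<close>

definition intertwines :: "(bipoly \<Rightarrow> lop fps) \<Rightarrow> nat \<Rightarrow> lop fps \<Rightarrow> bool" where
  "intertwines K n S \<longleftrightarrow> (\<forall>g. agree n (S * K g) (ext K S g))"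

lemma intertwines_ext:
  assumes "additive_map K" "intertwines K n S"
  shows "agree n (S * ext K T g) (ext K (S * T) g)"
proof -
  have "agree n (ext (\<lambda>h. S * K h) T g) (ext (\<lambda>h. ext K S h) T g)"
    using assms(2) by (intro agree_ext) (simp add: intertwines_def)
  then show ?thesis
    by (simp add: ext_mult_left ext_ext[OF assms(1)])
qed

lemma intertwines_mult_at:
  assumes "additive_map K" "intertwines K n S" "agree n (T * K g) (ext K T g)"
  shows "agree n (S * T * K g) (ext K (S * T) g)"
  using agree_trans[OF agree_mult_left[OF assms(3), of S] intertwines_ext[OF assms(1,2), of T g]]
  by (simp add: mult.assoc)

lemma intertwines_mult: "additive_map K \<Longrightarrow> intertwines K n S \<Longrightarrow> intertwines K n T \<Longrightarrow> intertwines K n (S * T)"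
  using intertwines_mult_at[of K n S T] by (simp add: intertwines_def)

lemma intertwines_add: "additive_map K \<Longrightarrow> intertwines K n S \<Longrightarrow> intertwines K n T \<Longrightarrow> intertwines K n (S + T)"
  by (simp add: intertwines_def ext_add agree_add distrib_right)

lemma intertwines_one: "additive_map K \<Longrightarrow> intertwines K n 1"
  by (simp add: intertwines_def ext_one)

lemma intertwines_const:
  assumes "additive_map K" "\<And>h. K (f * h) = fps_const (mul f) * K h"
  shows "intertwines K n (fps_const (mul f))"
  using ext_const_left[OF assms, where S = 1] by (simp add: intertwines_def ext_one assms)

text \<open>
  The new product is \<open>T (S f \<star> S g)\<close>: when two of its multiplications are composed, the inner
  factors \<open>S T\<close> cancel and associativity of \<open>\<star>\<close> applies.
\<close>

theorem gauge_star:
  assumes K: "additive_map K" "star K" and inv: "S * T = 1"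
  shows "star (\<lambda>f. T * ext K S f * S)"
  unfolding star_def
proof (intro allI)
  fix f g
  have intertwines_K: "intertwines K n (K h)" for n h
    using K(2) by (simp add: intertwines_def star_def)
  have intertwines_S: "ext K S f * K h = ext K (ext K S f) h" for h
  proof -
    have "ext K S f * K h = ext (\<lambda>u. K u * K h) S f"
      by (simp add: ext_mult_right)
    also have "\<dots> = ext (\<lambda>u. ext K (K u) h) S f"
      using K(2) by (simp add: star_def)
    finally show ?thesis by (simp add: ext_comp[OF K(1)])
  qed
  have mult: "ext K S f * ext K V g = ext K (ext K S f * V) g" for V
  proof -
    have "ext K S f * ext K V g = ext (\<lambda>h. ext K S f * K h) V g"
      by (simp add: ext_mult_left)
    also have "\<dots> = ext (\<lambda>h. ext K (ext K S f) h) V g"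
      by (simp add: intertwines_S)
    finally show ?thesis by (simp add: ext_ext[OF K(1)])
  qed
  have "ext (\<lambda>f. T * ext K S f * S) (T * ext K S f * S) g
      = T * ext K (S * (T * ext K S f * S)) g * S"
    by (simp add: ext_mult_right ext_mult_left ext_ext[OF K(1)])
  also have "S * (T * ext K S f * S) = ext K S f * S"
    using inv by (metis mult.assoc mult_1)
  also have "T * ext K (ext K S f * S) g * S = T * (ext K S f * ext K S g) * S"
    by (simp add: mult)
  also have "\<dots> = T * ext K S f * (S * T) * ext K S g * S"
    by (simp add: inv mult.assoc)
  finally show "(T * ext K S f * S) * (T * ext K S g * S)
      = ext (\<lambda>f. T * ext K S f * S) (T * ext K S f * S) g"
    by (simp add: mult.assoc)
qed

lemma additive_gauge: "additive_map K \<Longrightarrow> additive_map (\<lambda>f. T * ext K S f * S)"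
  unfolding additive_map_def
proof (intro allI)
  fix f g assume "\<forall>f g. K (f + g) = K f + K g"
  then have "ext K S (f + g) = ext K S f + ext K S g"
    by (intro fps_ext) (simp add: ext_nth app_add sum.distrib)
  then show "T * ext K S (f + g) * S = T * ext K S f * S + T * ext K S g * S"
    by (simp add: algebra_simps)
qed

section \<open>Normal ordering\<close>

text \<open>
  The divided derivatives \<open>\<partial>\<^sub>2\<^sup>m / m!\<close>, the coefficients of a Taylor expansion in \<open>y\<close>.
\<close>

definition dp2 :: "nat \<Rightarrow> bipoly \<Rightarrow> bipoly" where
  "dp2 m f = const_poly (1 / fact m) * (pd2 ^^ m) f"

text \<open>
  The normal-ordered substitution \<open>f(x, y + U)\<close>, expanded around \<open>y\<close>.  Summation over \<open>m \<le> n\<close>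
  loses nothing when \<open>U\<close> is divisible by \<open>t\<close>.
\<close>

definition nord :: "lop fps \<Rightarrow> bipoly \<Rightarrow> lop fps" where
  "nord U f = Abs_fps (\<lambda>n. \<Sum>m=0..n. mul (dp2 m f) * (U ^ m) $ n)"

lemma nord_nth: "nord U f $ n = (\<Sum>m=0..n. mul (dp2 m f) * (U ^ m) $ n)"
  by (simp add: nord_def)

lemma pd2_funpow_add: "(pd2 ^^ m) (f + g) = (pd2 ^^ m) f + (pd2 ^^ m) g"
  by (induction m) (simp_all add: pd2_add)

lemma dp2_add: "dp2 m (f + g) = dp2 m f + dp2 m g"
  by (simp add: dp2_def pd2_funpow_add algebra_simps)

lemma dp2_mult_const: "pd2 h = 0 \<Longrightarrow> dp2 m (h * f) = h * dp2 m f"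
proof -
  assume "pd2 h = 0"
  then have "(pd2 ^^ m) (h * f) = h * (pd2 ^^ m) f"
    by (induction m) (simp_all add: pd2_mult)
  then show ?thesis by (simp add: dp2_def algebra_simps)
qed

lemma dp2_0 [simp]: "dp2 0 f = f"
  by (simp add: dp2_def)

lemma pd2_funpow_vary:
  "(pd2 ^^ Suc m) (vary * f) = vary * (pd2 ^^ Suc m) f + const_poly (real (Suc m)) * (pd2 ^^ m) f"
proof (induction m)
  case 0
  show ?case by (simp add: pd2_mult)
next
  case (Suc m)
  have "(pd2 ^^ Suc (Suc m)) (vary * f) =
      pd2 (vary * (pd2 ^^ Suc m) f + const_poly (real (Suc m)) * (pd2 ^^ m) f)"
    using Suc by simp
  also have "\<dots> = vary * (pd2 ^^ Suc (Suc m)) f + (1 + const_poly (real (Suc m))) * (pd2 ^^ Suc m) f"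
    by (simp add: pd2_add pd2_mult algebra_simps)
  also have "1 + const_poly (real (Suc m)) = const_poly (real (Suc (Suc m)))"
    by (simp flip: single_one single_add)
  finally show ?case .
qed

lemma dp2_vary: "dp2 (Suc m) (vary * f) = vary * dp2 (Suc m) f + dp2 m f"
proof -
  have "const_poly (1 / fact (Suc m)) * (const_poly (real (Suc m)) * (pd2 ^^ m) f) = dp2 m f"
    by (simp add: dp2_def mult_single del: of_nat_Suc single_of_nat flip: mult.assoc)
  then show ?thesis
    unfolding dp2_def pd2_funpow_vary by (simp add: algebra_simps dp2_def)
qed

lemma additive_nord: "additive_map (nord U)"
  unfolding additive_map_def
  by (intro allI fps_ext) (simp add: nord_nth dp2_add mul_add distrib_right sum.distrib)

lemma nord_mult_const: "pd2 h = 0 \<Longrightarrow> nord U (h * f) = fps_const (mul h) * nord U f"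
  by (rule fps_ext) (simp add: nord_nth dp2_mult_const mul_mult sum_distrib_left mult.assoc)

text \<open>
  The last assumption is the commutation relation \<open>Y x = x Y + t P(x, Y)\<close> for \<open>Y = y + U\<close>; the
  second and third ones make \<open>Y\<close> act on powers of \<open>y\<close> as plain multiplication by \<open>y\<close>.
\<close>

locale normal_ordering =
  fixes P :: bipoly and U :: "lop fps"
  assumes U_0: "U $ 0 = 0"
    and U_one: "app (U $ k) 1 = 0"
    and U_vary: "U $ k * mul vary = mul vary * U $ k"
    and U_varx: "U $ Suc k * mul varx = mul varx * U $ Suc k + nord U P $ k"
begin

definition Y :: "lop fps" where "Y = fps_const (mul vary) + U"

lemma U_power_nth: "n < m \<Longrightarrow> (U ^ m) $ n = 0"
proof (induction m arbitrary: n)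
  case (Suc m)
  have "U $ i * (U ^ m) $ (n - i) = 0" if "i \<le> n" for i
    using Suc that by (cases i) (auto simp: U_0)
  then show ?case by (simp add: fps_mult_nth)
qed simp

lemma nord_one: "nord U 1 = 1"
proof (rule fps_ext)
  fix n
  have "dp2 (Suc m) 1 = 0" for m
  proof -
    have "pd2 0 = 0" "pd2 1 = 0" using pd2_const[of 0] pd2_const[of 1] by simp_all
    then have "(pd2 ^^ Suc m) 1 = 0"
      by (induction m) simp_all
    then show ?thesis by (simp add: dp2_def)
  qed
  then have "nord U 1 $ n = (\<Sum>m=0..n. if m = 0 then (U ^ m) $ n else 0)"
    unfolding nord_nth by (intro sum.cong refl) (metis dp2_0 mul_0 mul_1 mult_1 mult_zero_left not0_implies_Suc)
  then show "nord U 1 $ n = 1 $ n" by simp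
qed

text \<open>
  Together with \<open>nord_one\<close> and \<open>nord_mult_const\<close> this identifies the operator series of a monomial
  \<open>x\<^sup>i y\<^sup>j\<close> with \<open>x\<^sup>i Y\<^sup>j\<close>.
\<close>

lemma nord_vary: "nord U (vary * f) = nord U f * Y"
proof (rule fps_ext)
  fix n
  have "(nord U f * U) $ n = (\<Sum>i=0..n. \<Sum>m=0..i. mul (dp2 m f) * ((U ^ m) $ i * U $ (n - i)))"
    by (simp add: fps_mult_nth nord_nth sum_distrib_right mult.assoc)
  also have "\<dots> = (\<Sum>i=0..n. \<Sum>m=0..n. mul (dp2 m f) * ((U ^ m) $ i * U $ (n - i)))"
    by (intro sum.cong refl sum.mono_neutral_left) (auto simp: U_power_nth)
  also have "\<dots> = (\<Sum>m=0..n. mul (dp2 m f) * (U ^ Suc m) $ n)"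
    by (subst sum.swap) (simp add: fps_mult_nth power_Suc2 sum_distrib_left del: power_Suc)
  finally have 1: "(nord U f * U) $ n = (\<Sum>m=0..n. mul (dp2 m f) * (U ^ Suc m) $ n)" .
  have comm: "(U ^ m) $ k * mul vary = mul vary * (U ^ m) $ k" for m k
  proof (induction m arbitrary: k)
    case (Suc m)
    have "U $ i * ((U ^ m) $ (k - i) * mul vary) = mul vary * (U $ i * (U ^ m) $ (k - i))" for i
      unfolding Suc by (simp only: U_vary flip: mult.assoc)
    then show ?case by (simp add: fps_mult_nth sum_distrib_left sum_distrib_right mult.assoc)
  qed simp
  have 2: "(nord U f * fps_const (mul vary)) $ n = (\<Sum>m=0..n. mul (vary * dp2 m f) * (U ^ m) $ n)"
    by (simp add: nord_nth sum_distrib_right mult.assoc comm mul_mult)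
       (simp add: mul_commute flip: mult.assoc)
  have "nord U (vary * f) $ n = mul (vary * f) * (U ^ 0) $ n
      + (\<Sum>m=Suc 0..n. mul (dp2 m (vary * f)) * (U ^ m) $ n)"
    by (simp add: nord_nth sum.atLeast_Suc_atMost)
  also have "(\<Sum>m=Suc 0..n. mul (dp2 m (vary * f)) * (U ^ m) $ n)
      = (\<Sum>m=Suc 0..n. mul (vary * dp2 m f) * (U ^ m) $ n) + (\<Sum>m=Suc 0..n. mul (dp2 (m - 1) f) * (U ^ m) $ n)"
    by (subst sum.distrib[symmetric], rule sum.cong)
       (auto simp: dp2_vary mul_add distrib_right gr0_conv_Suc Suc_le_eq)
  also have "(\<Sum>m=Suc 0..n. mul (dp2 (m - 1) f) * (U ^ m) $ n) = (\<Sum>m=Suc 0..Suc n. mul (dp2 (m - 1) f) * (U ^ m) $ n)"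
    using U_power_nth[of n "Suc n"] by simp
  also have "\<dots> = (nord U f * U) $ n"
    unfolding 1 by (simp add: sum.shift_bounds_cl_Suc_ivl del: sum.cl_ivl_Suc)
  also have "mul (vary * f) * (U ^ 0) $ n + ((\<Sum>m=Suc 0..n. mul (vary * dp2 m f) * (U ^ m) $ n) + (nord U f * U) $ n)
      = (nord U f * fps_const (mul vary)) $ n + (nord U f * U) $ n"
    unfolding 2 by (simp add: sum.atLeast_Suc_atMost add.assoc)
  finally show "nord U (vary * f) $ n = (nord U f * Y) $ n"
    by (simp add: Y_def distrib_left)
qed

lemma Y_varx: "Y * fps_const (mul varx) = fps_const (mul varx) * Y + fps_X * nord U P"
proof (rule fps_ext)
  fix n show "(Y * fps_const (mul varx)) $ n = (fps_const (mul varx) * Y + fps_X * nord U P) $ n"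
    by (cases n) (simp_all add: Y_def U_0 U_varx mul_commute)
qed

text \<open>
  The operators \<open>f(x, Y)\<close> are generated by \<open>x\<close>, \<open>Y\<close> and the scalars.
\<close>

lemma intertwines_nord:
  assumes "intertwines (nord U) n Y"
  shows "intertwines (nord U) n (nord U f)"
proof (induction f rule: bipoly_induct)
  case one
  then show ?case by (simp add: nord_one intertwines_one additive_nord)
next
  case (varx f)
  then show ?case
    by (simp add: nord_mult_const intertwines_mult intertwines_const additive_nord)
next
  case (vary f)
  then show ?case by (simp add: nord_vary intertwines_mult assms additive_nord)
next
  case (scale c f)
  then show ?case by (simp add: nord_mult_const intertwines_mult intertwines_const additive_nord)
next
  case (add f g)
  then show ?case
    using additive_nord[of U] by (simp add: intertwines_add additive_map_def)
qed

lemma Y_vary_power: "ext (nord U) Y (xpow (0, j)) = nord U (xpow (0, Suc j))"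
proof (rule fps_ext)
  fix n
  have "app (U $ k) (xpow (0, j)) = 0" for k
  proof (induction j)
    case 0
    show ?case using U_one[of k] by (simp flip: zero_prod_def single_one)
  next
    case (Suc j)
    have "app (U $ k) (xpow (0, Suc j)) = app (U $ k * mul vary) (xpow (0, j))" by (simp add: xpow_Suc)
    also have "\<dots> = 0" unfolding U_vary using Suc by simp
    finally show ?case .
  qed
  then have "app (Y $ i) (xpow (0, j)) = (if i = 0 then xpow (0, Suc j) else 0)" for i
    by (simp add: Y_def xpow_Suc)
  then have "ext (nord U) Y (xpow (0, j)) $ n = (\<Sum>i=0..n. if i = 0 then nord U (xpow (0, Suc j)) $ (n - i) else 0)"
    unfolding ext_nth by (intro sum.cong) (simp_all add: additive_zero additive_nord)
  then show "ext (nord U) Y (xpow (0, j)) $ n = nord U (xpow (0, Suc j)) $ n" by simp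
qed

lemma Y_mult_vary_power: "Y * nord U (xpow (0, j)) = nord U (xpow (0, Suc j))"
proof -
  have "nord U (xpow (0, j)) = Y ^ j" for j
  proof (induction j)
    case 0
    show ?case using nord_one by (simp flip: zero_prod_def single_one)
  next
    case (Suc j)
    then show ?case unfolding xpow_Suc nord_vary by (simp add: power_Suc2 del: power_Suc)
  qed
  then show ?thesis by simp
qed

text \<open>
  The \<open>t\<close>-adic induction behind associativity.  On \<open>y\<^sup>j\<close> there is nothing to reorder.  On \<open>x g\<close> the
  relation replaces \<open>Y x\<close> by \<open>x Y + t P(x, Y)\<close>; the factor \<open>t\<close> in front of \<open>P(x, Y)\<close> raises
  the precision of the induction hypothesis from \<open>t\<^sup>n\<close> to the required \<open>t\<^sup>n\<^sup>+\<^sup>1\<close>.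
\<close>

lemma intertwines_Y: "intertwines (nord U) n Y"
proof (induction n)
  case 0
  show ?case by (simp add: intertwines_def agree_def)
next
  case (Suc n)
  note intertwines_n = Suc
  have x: "nord U (varx * h) = fps_const (mul varx) * nord U h" for h
    by (simp add: nord_mult_const)
  have intertwines_x: "intertwines (nord U) k (fps_const (mul varx))" for k
    by (rule intertwines_const[OF additive_nord x])
  have mono: "agree (Suc n) (Y * nord U (xpow (i, j))) (ext (nord U) Y (xpow (i, j)))" for i j
  proof (induction i)
    case 0
    show ?case by (simp add: Y_vary_power Y_mult_vary_power)
  next
    case (Suc i)
    let ?g = "xpow (i, j)"
    have g: "xpow (Suc i, j) = varx * ?g" by (rule xpow_Suc)
    have "Y * nord U (xpow (Suc i, j)) = (Y * fps_const (mul varx)) * nord U ?g"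
      by (simp add: g x mult.assoc)
    also have "\<dots> = fps_const (mul varx) * Y * nord U ?g + fps_X * (nord U P * nord U ?g)"
      by (simp add: Y_varx distrib_right mult.assoc)
    also have "agree (Suc n) \<dots> (ext (nord U) (fps_const (mul varx) * Y) ?g + fps_X * ext (nord U) (nord U P) ?g)"
      using intertwines_nord[OF intertwines_n]
      by (intro agree_add intertwines_mult_at agree_X additive_nord intertwines_x Suc) (simp add: intertwines_def)
    also have "\<dots> = ext (nord U) Y (xpow (Suc i, j))"
      by (simp add: g additive_nord flip: ext_X ext_add Y_varx ext_const_right)
    finally show ?case .
  qed
  show ?case
    unfolding intertwines_def
  proof
    fix g
    show "agree (Suc n) (Y * nord U g) (ext (nord U) Y g)"
    proof (induction g rule: bipoly_induct_add)
      case zero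
      show ?case by (simp add: additive_zero additive_nord agree_def ext_nth)
    next
      case (single m c)
      let ?c = "fps_const (mul (const_poly c))"
      have comm: "Y * ?c = ?c * Y"
        by (rule fps_ext) (simp add: scalar_commute)
      have "Y * nord U (Poly_Mapping.single m c) = (Y * ?c) * nord U (xpow m)"
        by (simp add: single_eq_xpow[of m c] nord_mult_const mult.assoc)
      also have "agree (Suc n) \<dots> (ext (nord U) (Y * ?c) (xpow m))"
        unfolding comm by (cases m) (auto intro!: intertwines_mult_at additive_nord intertwines_const nord_mult_const mono)
      also have "\<dots> = ext (nord U) Y (Poly_Mapping.single m c)"
        by (simp add: ext_const_right flip: single_eq_xpow)
      finally show ?case .
    next
      case (add f g)
      have "ext (nord U) Y (f + g) = ext (nord U) Y f + ext (nord U) Y g"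
        using additive_nord[of U] by (intro fps_ext) (simp add: ext_nth additive_map_def app_add sum.distrib)
      moreover have "nord U (f + g) = nord U f + nord U g"
        using additive_nord[of U] by (simp add: additive_map_def)
      ultimately show ?case
        using agree_add[OF add] by (simp add: distrib_left)
    qed
  qed
qed

theorem star_nord: "star (nord U)"
  unfolding star_def
proof (intro allI fps_ext)
  fix f g n
  have "agree (Suc n) (nord U f * nord U g) (ext (nord U) (nord U f) g)"
    using intertwines_nord[OF intertwines_Y] by (simp add: intertwines_def)
  then show "(nord U f * nord U g) $ n = ext (nord U) (nord U f) g $ n"
    by (simp add: agree_def)
qed

end

section \<open>The deformed coordinate operator\<close>

text \<open>
  The \<open>n\<close>-fold sumset, where the weights of the \<open>t\<^sup>n\<close>-coefficients live.
\<close>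

primrec sums_of :: "nat \<Rightarrow> (int \<times> int) set \<Rightarrow> (int \<times> int) set" where
  "sums_of 0 \<Delta> = {0}"
| "sums_of (Suc n) \<Delta> = {a + b | a b. a \<in> \<Delta> \<and> b \<in> sums_of n \<Delta>}"

lemma sums_of_SucI: "a \<in> \<Delta> \<Longrightarrow> b \<in> sums_of n \<Delta> \<Longrightarrow> a + b \<in> sums_of (Suc n) \<Delta>"
  by (simp only: sums_of.simps) blast

lemma sums_of_add: "v \<in> sums_of i \<Delta> \<Longrightarrow> w \<in> sums_of j \<Delta> \<Longrightarrow> v + w \<in> sums_of (i + j) \<Delta>"
proof (induction i arbitrary: v)
  case (Suc i)
  then obtain a b where ab: "v = a + b" "a \<in> \<Delta>" "b \<in> sums_of i \<Delta>"
    by (simp only: sums_of.simps) blast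
  with Suc.IH[of b] Suc.prems(2) have "a + (b + w) \<in> sums_of (Suc (i + j)) \<Delta>"
    by (intro sums_of_SucI)
  then show ?case by (simp only: ab add.assoc add_Suc)
qed simp

lemma sums_of_semigroup:
  assumes "additive_semigroup \<Delta>"
  shows "sums_of (Suc n) \<Delta> \<subseteq> \<Delta>"
proof (induction n)
  case 0
  show ?case by (simp only: sums_of.simps) (auto simp del: split_paired_Ex)
next
  case (Suc n)
  then show ?case
    using assms unfolding sums_of.simps(2)[of "Suc n"] additive_semigroup_def by blast
qed

lemma sums_of_ideal2:
  assumes "additive_semigroup \<Delta>" "n \<ge> 2"
  shows "sums_of n \<Delta> \<subseteq> {a + b | a b. a \<in> \<Delta> \<and> b \<in> \<Delta>}"
proof -
  obtain k where "n = Suc (Suc k)" using assms(2) by (metis One_nat_def Suc_1 Suc_le_D Suc_le_mono)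
  then show ?thesis using sums_of_semigroup[OF assms(1), of k] by (simp only: sums_of.simps(2)[of "Suc k"]) blast
qed

lemma lookup_const_mult: "Poly_Mapping.lookup (const_poly c * f) a = c * Poly_Mapping.lookup f a"
proof (induction f rule: bipoly_induct_add)
  case (single m d)
  show ?case by (simp add: mult_single lookup_single when_def)
qed (simp_all add: lookup_add algebra_simps)

lemma keys_const_mult: "Poly_Mapping.keys (const_poly c * f) \<subseteq> Poly_Mapping.keys f"
  by (auto simp: in_keys_iff lookup_const_mult)

lemma keys_pd: "b \<in> Poly_Mapping.keys (pd a f) \<Longrightarrow> b + a \<in> Poly_Mapping.keys f"
proof -
  have 2: "Poly_Mapping.lookup ((pd2 ^^ m) f) (i, j) \<noteq> 0 \<Longrightarrow> Poly_Mapping.lookup f (i, j + m) \<noteq> 0" for i j m f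
  proof (induction m arbitrary: j)
    case (Suc m)
    then show ?case using Suc.IH[of "Suc j"] by (auto simp: lookup_pd2)
  qed simp
  have 1: "Poly_Mapping.lookup ((pd1 ^^ m) f) (i, j) \<noteq> 0 \<Longrightarrow> Poly_Mapping.lookup f (i + m, j) \<noteq> 0" for i j m f
  proof (induction m arbitrary: i)
    case (Suc m)
    then show ?case using Suc.IH[of "Suc i"] by (auto simp: lookup_pd1)
  qed simp
  show "b \<in> Poly_Mapping.keys (pd a f) \<Longrightarrow> b + a \<in> Poly_Mapping.keys f"
    using 1 2 by (cases a; cases b) (simp add: in_keys_iff pd_def)
qed

lemma keys_dp2:
  assumes "a \<in> Poly_Mapping.keys (dp2 m f)"
  shows "a + (0, m) \<in> Poly_Mapping.keys f"
proof -
  have "a \<in> Poly_Mapping.keys (pd (0, m) f)"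
    using assms keys_const_mult by (auto simp: dp2_def pd_def)
  then show ?thesis by (rule keys_pd)
qed

lemma fps_power_cong:
  fixes F G :: "lop fps"
  assumes "\<And>i. i \<le> n \<Longrightarrow> F $ i = G $ i" "k \<le> n"
  shows "(F ^ m) $ k = (G ^ m) $ k"
  using assms(2)
proof (induction m arbitrary: k)
  case (Suc m)
  then show ?case using assms(1) by (auto simp: fps_mult_nth intro!: sum.cong)
qed simp

text \<open>
  The shift by the weight \<open>(0, 1)\<close> of \<open>y\<close> is there because \<open>U\<close> deforms multiplication by \<open>y\<close>.
\<close>

lemma diffop_power:
  assumes "\<And>i. i \<le> n \<Longrightarrow> U $ i \<in> diffop {0} ((+) (0, 1) ` sums_of i \<Delta>)" "k \<le> n"
  shows "(U ^ m) $ k \<in> diffop {0} ((+) (0, int m) ` sums_of k \<Delta>)"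
  using assms(2)
proof (induction m arbitrary: k)
  case 0
  show ?case by (cases k) (auto intro: diffop_one diffop.zero simp flip: zero_prod_def)
next
  case (Suc m)
  have "U $ i * (U ^ m) $ (k - i) \<in> diffop {0} ((+) (0, int (Suc m)) ` sums_of k \<Delta>)" if "i \<le> k" for i
  proof (rule diffop_mult[OF assms(1) Suc.IH])
    fix v w assume "v \<in> (+) (0, 1) ` sums_of i \<Delta>" "w \<in> (+) (0, int m) ` sums_of (k - i) \<Delta>"
    then obtain v' w' where "v = (0, 1) + v'" "v' \<in> sums_of i \<Delta>" "w = (0, int m) + w'" "w' \<in> sums_of (k - i) \<Delta>"
      by blast
    moreover from this have "v' + w' \<in> sums_of k \<Delta>" using sums_of_add[of v' i \<Delta> w' "k - i"] that by simp
    ultimately show "v + w \<in> (+) (0, int (Suc m)) ` sums_of k \<Delta>"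
      by (cases v'; cases w') (auto simp: image_iff intro!: bexI[of _ "v' + w'"])
  qed (use that Suc.prems in auto)
  then show ?case by (auto simp: fps_mult_nth intro: diffop_sum)
qed

text \<open>
  The shifts cancel: \<open>\<partial>\<^sub>2\<^sup>m\<close> lowers the weight of \<open>P\<close> by \<open>(0, m)\<close>, while \<open>U\<^sup>m\<close> raises it by the
  same amount.  What remains is \<open>n\<close> summands from \<open>U\<close>, one more from \<open>P\<close>, and the weight \<open>(1, 1)\<close>
  of \<open>x y\<close>.
\<close>

lemma diffop_nord:
  assumes U: "\<And>i. i \<le> n \<Longrightarrow> U $ i \<in> diffop {0} ((+) (0, 1) ` sums_of i \<Delta>)"
    and P: "\<And>a. a \<in> Poly_Mapping.keys P \<Longrightarrow> int_index a - (1, 1) \<in> \<Delta>"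
  shows "nord U P $ n \<in> diffop {0} ((+) (1, 1) ` sums_of (Suc n) \<Delta>)"
  unfolding nord_nth
proof (rule diffop_sum)
  fix m
  have "mul (dp2 m P) \<in> diffop {0} {v. v - (1, 1) + (0, int m) \<in> \<Delta>}"
  proof (rule diffop_mul)
    fix a assume "a \<in> Poly_Mapping.keys (dp2 m P)"
    from P[OF keys_dp2[OF this]] show "int_index a \<in> {v. v - (1, 1) + (0, int m) \<in> \<Delta>}"
      by (cases a) (simp add: int_index_def algebra_simps)
  qed simp
  then show "mul (dp2 m P) * (U ^ m) $ n \<in> diffop {0} ((+) (1, 1) ` sums_of (Suc n) \<Delta>)"
  proof (rule diffop_mult[OF _ diffop_power[OF U order_refl]])
    fix v w assume v: "v \<in> {v. v - (1, 1) + (0, int m) \<in> \<Delta>}" and "w \<in> (+) (0, int m) ` sums_of n \<Delta>"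
    then obtain w' where w: "w' \<in> sums_of n \<Delta>" "w = (0, int m) + w'" by blast
    have "(v - (1, 1) + (0, int m)) + w' \<in> sums_of (Suc n) \<Delta>"
      using v w by (intro sums_of_SucI) auto
    moreover have "v + w = (1, 1) + ((v - (1, 1) + (0, int m)) + w')"
      using w by (cases v; cases w') simp
    ultimately show "v + w \<in> (+) (1, 1) ` sums_of (Suc n) \<Delta>" by blast
  qed auto
qed

text \<open>
  The coefficient of \<open>t\<^sup>n\<close> in \<open>P(x, Y)\<close> involves \<open>U\<close> up to order \<open>n\<close> only, and the next
  coefficient of \<open>U\<close> is obtained from it by integration.  At order one the integral is chosen to be
  \<open>P \<partial>\<^sub>1\<close>, which fixes the first-order term of the star product.
\<close>

theorem normal_ordering_exists:
  assumes P: "\<And>a. a \<in> Poly_Mapping.keys P \<Longrightarrow> int_index a - (1, 1) \<in> \<Delta>"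
  obtains U where "normal_ordering P U" "\<And>k. U $ k \<in> diffop {0} ((+) (0, 1) ` sums_of k \<Delta>)"
    "U $ 1 = mul P * dx"
proof -
  define V where "V k = (+) (0, 1) ` sums_of k \<Delta>" for k
  \<comment> \<open>\<open>Q f k r\<close>: \<open>r\<close> may serve as coefficient \<open>k\<close> of \<open>U\<close> when the earlier ones are given by \<open>f\<close>.\<close>
  define Q where "Q f k r = (case k of 0 \<Rightarrow> r = 0 | Suc n \<Rightarrow>
      r \<in> diffop {0} (V k) \<and> r * mul varx = mul varx * r + nord (Abs_fps f) P $ n \<and> app r 1 = 0 \<and>
      (n = 0 \<longrightarrow> r = mul P * dx))" for f k r
  have Q_mem: "r \<in> diffop {0} (V k)" if "Q f k r" for f k r
    using that by (cases k) (auto simp: Q_def diffop.zero)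
  have "\<exists>f. \<forall>k. Q f k (f k)"
  proof (rule dependent_wellorder_choice)
    fix r :: lop and f g :: "nat \<Rightarrow> lop" and k
    assume eq: "\<And>y. y < k \<Longrightarrow> f y = g y"
    have "nord (Abs_fps f) P $ n = nord (Abs_fps g) P $ n" if "k = Suc n" for n
      unfolding nord_nth using that eq
      by (intro sum.cong refl arg_cong2[where f = "(*)"] fps_power_cong[where n = n]) auto
    then show "Q f k r = Q g k r" by (cases k) (simp_all add: Q_def)
  next
    fix k and f :: "nat \<Rightarrow> lop"
    assume prev: "\<And>y. y < k \<Longrightarrow> Q f y (f y)"
    show "\<exists>r. Q f k r"
    proof (cases k)
      case (Suc n)
      have "nord (Abs_fps f) P $ n \<in> diffop {0} ((+) (1, 1) ` sums_of k \<Delta>)"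
        unfolding Suc using Q_mem[OF prev] Suc by (intro diffop_nord P) (auto simp: V_def)
      moreover have "v - (1, 0) \<in> V k" if "v \<in> (+) (1, 1) ` sums_of k \<Delta>" for v
        using that unfolding V_def by (auto simp: image_iff intro!: bexI)
      ultimately obtain R where R: "R \<in> diffop {0} (V k)"
        "R * mul varx = mul varx * R + nord (Abs_fps f) P $ n" "app R 1 = 0"
        using diffop_x_integrate by meson
      show ?thesis
      proof (cases "n = 0")
        case False
        then show ?thesis using R Suc by (auto simp: Q_def)
      next
        case True
        have "mul P \<in> diffop {0} ((+) (1, 1) ` \<Delta>)"
        proof (rule diffop_mul)
          fix a assume "a \<in> Poly_Mapping.keys P"
          moreover have "int_index a = (1, 1) + (int_index a - (1, 1))" by simp
          ultimately show "int_index a \<in> (+) (1, 1) ` \<Delta>" using P by blast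
        qed simp
        moreover have "dx \<in> diffop {0} ((+) (-1, 0) ` {0})"
          using diffop_dx_mult[OF diffop_one[of "{0}" "{0}"]] by simp
        ultimately have "mul P * dx \<in> diffop {0} (V k)"
        proof (rule diffop_mult)
          fix v w assume "v \<in> (+) (1, 1) ` \<Delta>" "w \<in> (+) (- 1, 0) ` {0 :: int \<times> int}"
          then show "v + w \<in> V k"
            using Suc True by (auto simp: V_def image_iff zero_prod_def intro!: bexI)
        qed simp
        moreover have "mul P * dx * mul varx = mul varx * (mul P * dx) + nord (Abs_fps f) P $ n"
          using True by (simp add: nord_nth mult.assoc dx_mul distrib_left)
            (simp add: mul_commute flip: mult.assoc)
        moreover have "app (mul P * dx) 1 = 0"
          using pd1_const[of 1] by simp
        ultimately show ?thesis using Suc True by (auto simp: Q_def)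
      qed
    qed (simp add: Q_def)
  qed
  then obtain f where f: "\<And>k. Q f k (f k)" by blast
  define U where "U = Abs_fps f"
  have mem: "U $ k \<in> diffop {0} (V k)" for k
    using Q_mem[OF f] by (simp add: U_def)
  have "normal_ordering P U"
  proof
    show "U $ 0 = 0" using f[of 0] by (simp add: U_def Q_def)
    then show "app (U $ k) 1 = 0" for k
      using f[of k] by (cases k) (simp_all add: U_def Q_def)
    show "U $ k * mul vary = mul vary * U $ k" for k
      using diffop_x_commute_vary[OF mem] .
    show "U $ Suc k * mul varx = mul varx * U $ Suc k + nord U P $ k" for k
      using f[of "Suc k"] by (simp add: U_def Q_def)
  qed
  moreover have "U $ 1 = mul P * dx" using f[of 1] by (simp add: U_def Q_def)
  ultimately show thesis using that mem by (simp add: V_def)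
qed

section \<open>Bidifferential operators as cochains\<close>

text \<open>
  Products of two arbitrary differential operators, instead of normal-ordered monomials, make closure
  under composition with an operator in either argument immediate; normal form is needed only when
  passing to cochains.
\<close>

inductive_set bidiff :: "(int \<times> int) set \<Rightarrow> (bipoly \<Rightarrow> bipoly \<Rightarrow> bipoly) set" for V where
  zero: "(\<lambda>f g. 0) \<in> bidiff V"
| add: "\<phi> \<in> bidiff V \<Longrightarrow> \<psi> \<in> bidiff V \<Longrightarrow> (\<lambda>f g. \<phi> f g + \<psi> f g) \<in> bidiff V"
| prod: "D \<in> diffop UNIV V1 \<Longrightarrow> E \<in> diffop UNIV V2 \<Longrightarrow> (\<And>v w. v \<in> V1 \<Longrightarrow> w \<in> V2 \<Longrightarrow> v + w \<in> V) \<Longrightarrow>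
    (\<lambda>f g. app D f * app E g) \<in> bidiff V"

lemma bidiff_mono: "\<phi> \<in> bidiff V \<Longrightarrow> V \<subseteq> V' \<Longrightarrow> \<phi> \<in> bidiff V'"
  by (induction rule: bidiff.induct) (blast intro: bidiff.intros)+

lemma bidiff_sum: "(\<And>s. s \<in> S \<Longrightarrow> (\<lambda>f g. \<phi> s f g) \<in> bidiff V) \<Longrightarrow> (\<lambda>f g. \<Sum>s\<in>S. \<phi> s f g) \<in> bidiff V"
  by (induction S rule: infinite_finite_induct) (auto intro: bidiff.intros)

lemma bidiff_pre1:
  assumes "\<phi> \<in> bidiff V" and D: "D \<in> diffop UNIV W" and V: "\<And>v w. v \<in> V \<Longrightarrow> w \<in> W \<Longrightarrow> v + w \<in> V'"
  shows "(\<lambda>f g. \<phi> (app D f) g) \<in> bidiff V'"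
  using assms(1)
proof (induction rule: bidiff.induct)
  case (prod D1 V1 E V2)
  have "D1 * D \<in> diffop UNIV {v + w |v w. v \<in> V1 \<and> w \<in> W}"
    using prod(1) D by (rule diffop_mult) blast+
  then have "(\<lambda>f g. app (D1 * D) f * app E g) \<in> bidiff V'"
  proof (rule bidiff.prod[OF _ prod(2)])
    fix v w assume "v \<in> {v + w |v w. v \<in> V1 \<and> w \<in> W}" "w \<in> V2"
    then obtain a b where "v = a + b" "a \<in> V1" "b \<in> W" by blast
    then show "v + w \<in> V'"
      using V[OF prod(3)[of a w], of b] \<open>w \<in> V2\<close> by (simp add: ac_simps)
  qed
  then show ?case by simp
qed (auto intro: bidiff.intros)

lemma bidiff_pre2:
  assumes "\<phi> \<in> bidiff V" and D: "D \<in> diffop UNIV W" and V: "\<And>v w. v \<in> V \<Longrightarrow> w \<in> W \<Longrightarrow> v + w \<in> V'"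
  shows "(\<lambda>f g. \<phi> f (app D g)) \<in> bidiff V'"
  using assms(1)
proof (induction rule: bidiff.induct)
  case (prod E V1 D1 V2)
  have "D1 * D \<in> diffop UNIV {v + w |v w. v \<in> V2 \<and> w \<in> W}"
    using prod(2) D by (rule diffop_mult) blast+
  then have "(\<lambda>f g. app E f * app (D1 * D) g) \<in> bidiff V'"
  proof (rule bidiff.prod[OF prod(1)])
    fix v w assume "v \<in> V1" "w \<in> {v + w |v w. v \<in> V2 \<and> w \<in> W}"
    then obtain a b where "w = a + b" "a \<in> V2" "b \<in> W" by blast
    then show "v + w \<in> V'"
      using V[OF prod(3)[of v a], of b] \<open>v \<in> V1\<close> by (simp add: ac_simps)
  qed
  then show ?case by simp
qed (auto intro: bidiff.intros)

lemma shifted_sum_left: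
  fixes s :: "int \<times> int"
  assumes V: "\<And>v w. v \<in> V1 \<Longrightarrow> w \<in> V2 \<Longrightarrow> v + w \<in> V" and v: "v \<in> (+) s ` V1" and w: "w \<in> V2"
  shows "v + w \<in> (+) s ` V"
proof -
  obtain v' where v': "v = s + v'" "v' \<in> V1" using v by blast
  then have "v + w = s + (v' + w)" by (simp only: add.assoc)
  then show ?thesis using V[OF v'(2) w] by blast
qed

lemma shifted_sum_right:
  fixes s :: "int \<times> int"
  assumes V: "\<And>v w. v \<in> V1 \<Longrightarrow> w \<in> V2 \<Longrightarrow> v + w \<in> V" and v: "v \<in> V1" and w: "w \<in> (+) s ` V2"
  shows "v + w \<in> (+) s ` V"
  using shifted_sum_left[of V2 V1 V w s v] assms by (metis add.commute)

lemma bidiff_single_mult: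
  assumes "\<phi> \<in> bidiff V"
  shows "(\<lambda>f g. Poly_Mapping.single b d * \<phi> f g) \<in> bidiff ((+) (int_index b) ` V)"
  using assms
proof (induction rule: bidiff.induct)
  case (prod D V1 E V2)
  have "(\<lambda>f g. app (mul (Poly_Mapping.single b d) * D) f * app E g) \<in> bidiff ((+) (int_index b) ` V)"
    by (rule bidiff.prod[OF diffop_single_mult[OF prod(1)] prod(2)]) (rule shifted_sum_left[OF prod(3)])
  then show ?case by (simp add: mult.assoc)
qed (auto simp: distrib_left intro: bidiff.intros)

lemma bidiff_derivation:
  assumes "\<phi> \<in> bidiff V" and der: "\<And>f g. app D (f * g) = app D f * g + f * app D g"
    and shift: "\<And>E W. E \<in> diffop UNIV W \<Longrightarrow> D * E \<in> diffop UNIV ((+) s ` W)"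
  shows "(\<lambda>f g. app D (\<phi> f g)) \<in> bidiff ((+) s ` V)"
  using assms(1)
proof (induction rule: bidiff.induct)
  case (prod D1 V1 E V2)
  have "(\<lambda>f g. app (D * D1) f * app E g) \<in> bidiff ((+) s ` V)"
    by (rule bidiff.prod[OF shift[OF prod(1)] prod(2)]) (rule shifted_sum_left[OF prod(3)])
  moreover have "(\<lambda>f g. app D1 f * app (D * E) g) \<in> bidiff ((+) s ` V)"
    by (rule bidiff.prod[OF prod(1) shift[OF prod(2)]]) (rule shifted_sum_right[OF prod(3)])
  ultimately have "(\<lambda>f g. app (D * D1) f * app E g + app D1 f * app (D * E) g) \<in> bidiff ((+) s ` V)"
    by (rule bidiff.add)
  then show ?case by (simp add: der)
qed (auto simp: app_add intro: bidiff.intros)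

text \<open>
  The linear weight function \<open>r n = n s\<close> is kept abstract, so that each derivation can supply the
  coordinate form of its weight.
\<close>

lemma bidiff_derivation_power:
  assumes "\<phi> \<in> bidiff V" and step: "\<And>\<psi> W. \<psi> \<in> bidiff W \<Longrightarrow> (\<lambda>f g. app D (\<psi> f g)) \<in> bidiff ((+) s ` W)"
    and r: "\<And>n. r (Suc n) = s + r n" "r 0 = (0 :: int \<times> int)"
  shows "(\<lambda>f g. app (D ^ n) (\<phi> f g)) \<in> bidiff ((+) (r n) ` V)"
proof (induction n)
  case 0
  show ?case using assms(1) by (simp add: r)
next
  case (Suc n)
  from step[OF Suc] show ?case
    by (simp add: r image_comp comp_def add.assoc)
qed

text \<open>
  Composition on the outside is the one place where the Leibniz rule spreads derivatives over both
  arguments.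
\<close>

lemma bidiff_post:
  assumes "D \<in> diffop UNIV W" and \<phi>: "\<phi> \<in> bidiff V"
    and V: "\<And>v w. v \<in> W \<Longrightarrow> w \<in> V \<Longrightarrow> v + w \<in> V'"
  shows "(\<lambda>f g. app D (\<phi> f g)) \<in> bidiff V'"
  using assms(1)
proof (induction rule: diffop.induct)
  case (mon j a i c)
  have "(\<lambda>f g. app (dy ^ j) (\<phi> f g)) \<in> bidiff ((+) (0, - int j) ` V)"
    by (rule bidiff_derivation_power[OF \<phi> bidiff_derivation, where s = "(0, -1)"])
      (auto intro: diffop_dy_mult simp: pd2_mult zero_prod_def)
  then have "(\<lambda>f g. app (dx ^ i) (app (dy ^ j) (\<phi> f g))) \<in> bidiff ((+) (- int i, 0) ` (+) (0, - int j) ` V)"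
    by (rule bidiff_derivation_power[OF _ bidiff_derivation, where s = "(-1, 0)"])
      (auto intro: diffop_dx_mult simp: pd1_mult zero_prod_def)
  then have *: "(\<lambda>f g. Poly_Mapping.single a c * (app (dx ^ i) (app (dy ^ j) (\<phi> f g))))
      \<in> bidiff ((+) (int_index a) ` (+) (- int i, 0) ` (+) (0, - int j) ` V)"
    by (rule bidiff_single_mult)
  have "int_index a + ((- int i, 0) + ((0, - int j) + w)) \<in> V'" if "w \<in> V" for w
  proof -
    have "int_index a + ((- int i, 0) + ((0, - int j) + w)) = int_index a - (int i, int j) + w"
      by (cases w) (simp add: int_index_def)
    then show ?thesis using V[OF mon(2) that] by (simp only:)
  qed
  then have "(+) (int_index a) ` (+) (- int i, 0) ` (+) (0, - int j) ` V \<subseteq> V'"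
    by blast
  from bidiff_mono[OF * this] show ?case by simp
qed (auto intro: bidiff.intros)

definition bicochain :: "(bipoly \<Rightarrow> bipoly \<Rightarrow> bipoly) \<Rightarrow> cochain" where
  "bicochain \<phi> = (\<lambda>us. if length us = 2 then \<phi> (us ! 0) (us ! 1) else 0)"

lemma app_power: "app (D ^ n) f = (app D ^^ n) f"
  by (induction n) simp_all

lemma app_monomial: "app (mul (Poly_Mapping.single a c) * dx ^ i * dy ^ j) f
    = Poly_Mapping.single a c * pd (i, j) f"
proof -
  have "app dx = pd1" "app dy = pd2" by (simp_all add: fun_eq_iff)
  then show ?thesis by (simp add: app_power pd_def)
qed

lemma bicochain_span_zero: "bicochain (\<lambda>f g. 0) \<in> cochain.span S"
proof -
  have "bicochain (\<lambda>f g. 0) = 0" by (auto simp: bicochain_def fun_eq_iff)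
  then show ?thesis using cochain.span_zero[of S] by simp
qed

lemma bicochain_span_add:
  assumes "bicochain \<phi> \<in> cochain.span S" "bicochain \<psi> \<in> cochain.span S"
  shows "bicochain (\<lambda>f g. \<phi> f g + \<psi> f g) \<in> cochain.span S"
proof -
  have "bicochain (\<lambda>f g. \<phi> f g + \<psi> f g) = bicochain \<phi> + bicochain \<psi>"
    by (auto simp: bicochain_def fun_eq_iff)
  then show ?thesis using cochain.span_add[OF assms] by simp
qed

lemma bicochain_monomial:
  "bicochain (\<lambda>f g. app (mul (Poly_Mapping.single a c) * dx ^ i * dy ^ j) f
      * app (mul (Poly_Mapping.single b d) * dx ^ k * dy ^ l) g)
    = cscale (c * d) (diffmon (a + b) [(i, j), (k, l)])"
proof
  fix us :: "bipoly list"
  have 1: "Poly_Mapping.single a c * u * (Poly_Mapping.single b d * v) =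
      const_poly (c * d) * (xpow (a + b) * (u * v))" for u v
  proof -
    have "Poly_Mapping.single a c * u * (Poly_Mapping.single b d * v) =
        Poly_Mapping.single a c * Poly_Mapping.single b d * (u * v)"
      by (simp only: ac_simps)
    also have "\<dots> = const_poly (c * d) * xpow (a + b) * (u * v)"
      by (simp add: mult_single)
    finally show ?thesis by (simp only: mult.assoc)
  qed
  show "bicochain (\<lambda>f g. app (mul (Poly_Mapping.single a c) * dx ^ i * dy ^ j) f
      * app (mul (Poly_Mapping.single b d) * dx ^ k * dy ^ l) g) us
    = cscale (c * d) (diffmon (a + b) [(i, j), (k, l)]) us"
  proof (cases "length us = 2")
    case True
    then obtain f g where "us = [f, g]"
      by (metis (no_types) One_nat_def Suc_1 length_0_conv length_Suc_conv)
    then show ?thesis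
      unfolding app_monomial by (simp add: bicochain_def cscale_def diffmon_def 1)
  qed (simp add: bicochain_def cscale_def diffmon_def)
qed

lemma bicochain_bidiff:
  assumes "\<phi> \<in> bidiff V"
  shows "bicochain \<phi> \<in> cochain.span {diffmon a as | a as. length as = 2 \<and> weight a as \<in> V}"
    (is "_ \<in> cochain.span ?S")
  using assms
proof (induction rule: bidiff.induct)
  case (prod D V1 E V2)
  from prod(1) show ?case
  proof (induction rule: diffop.induct)
    case (mon j a i c)
    note m1 = mon
    from prod(2) show ?case
    proof (induction rule: diffop.induct)
      case (mon l b k d)
      have "weight (a + b) [(i, j), (k, l)] = int_index a - (int i, int j) + (int_index b - (int k, int l))"
        by (simp add: weight_def int_index_def)
      then have "weight (a + b) [(i, j), (k, l)] \<in> V"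
        using prod(3)[OF m1(2) mon(2)] by simp
      then have "diffmon (a + b) [(i, j), (k, l)] \<in> ?S"
        by (intro CollectI exI[of _ "a + b"] exI[of _ "[(i, j), (k, l)]"]) simp
      then show ?case
        unfolding bicochain_monomial by (intro cochain.span_scale cochain.span_base)
    next
      case zero
      show ?case using bicochain_span_zero by simp
    next
      case (add D E)
      then show ?case
        unfolding app_ring_simps distrib_left by (intro bicochain_span_add)
    qed
  next
    case zero
    show ?case using bicochain_span_zero by simp
  next
    case (add D E)
    then show ?case
      unfolding app_ring_simps distrib_right by (intro bicochain_span_add)
  qed
qed (auto intro: bicochain_span_zero bicochain_span_add)

lemma bicochain_in_cochains: "\<phi> \<in> bidiff V \<Longrightarrow> bicochain \<phi> \<in> cochains 2"
  unfolding cochains_def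
  by (rule subsetD[OF cochain.span_mono bicochain_bidiff]) auto

lemma bicochain_in_graded_part:
  assumes "\<phi> \<in> bidiff V" shows "bicochain \<phi> \<in> graded_part V"
proof -
  have "diffmon a as \<in> (\<Union>a\<in>V. weight_space a)" if "weight a as \<in> V" for a as
  proof (rule UN_I[OF that])
    show "diffmon a as \<in> weight_space (weight a as)"
      unfolding weight_space_def by (rule cochain.span_base) blast
  qed
  then show ?thesis
    unfolding graded_part_def
    by (intro subsetD[OF cochain.span_mono bicochain_bidiff[OF assms]]) auto
qed

section \<open>Quantization of a bivector in the plane\<close>

definition bidiff_series :: "(int \<times> int) set \<Rightarrow> (bipoly \<Rightarrow> lop fps) \<Rightarrow> bool" where
  "bidiff_series \<Delta> K \<longleftrightarrow> (\<forall>n. (\<lambda>f g. app (K f $ n) g) \<in> bidiff (sums_of n \<Delta>))"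

lemma sums_of_add_le: "i \<le> n \<Longrightarrow> v \<in> sums_of i \<Delta> \<Longrightarrow> w \<in> sums_of (n - i) \<Delta> \<Longrightarrow> v + w \<in> sums_of n \<Delta>"
  using sums_of_add[of v i \<Delta> w "n - i"] by simp

lemma sums_of_add_le': "i \<le> n \<Longrightarrow> v \<in> sums_of (n - i) \<Delta> \<Longrightarrow> w \<in> sums_of i \<Delta> \<Longrightarrow> v + w \<in> sums_of n \<Delta>"
  using sums_of_add[of v "n - i" \<Delta> w i] by simp

lemma bidiff_series_gauge:
  assumes K: "bidiff_series \<Delta> K" and S: "\<And>n. S $ n \<in> diffop UNIV (sums_of n \<Delta>)"
    and T: "\<And>n. T $ n \<in> diffop UNIV (sums_of n \<Delta>)"
  shows "bidiff_series \<Delta> (\<lambda>f. T * ext K S f * S)"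
proof -
  have 1: "bidiff_series \<Delta> (\<lambda>f. ext K S f)"
    unfolding bidiff_series_def
  proof
    fix n
    have "(\<lambda>f g. app (K (app (S $ i) f) $ (n - i)) g) \<in> bidiff (sums_of n \<Delta>)" if "i \<le> n" for i
      using bidiff_pre1[OF K[unfolded bidiff_series_def, rule_format, of "n - i"] S[of i] sums_of_add_le'[OF that]] .
    then show "(\<lambda>f g. app (ext K S f $ n) g) \<in> bidiff (sums_of n \<Delta>)"
      unfolding ext_nth app_sum_left by (intro bidiff_sum) simp
  qed
  have 2: "bidiff_series \<Delta> (\<lambda>f. T * ext K S f)"
    unfolding bidiff_series_def
  proof
    fix n
    have "(\<lambda>f g. app (T $ i) (app (ext K S f $ (n - i)) g)) \<in> bidiff (sums_of n \<Delta>)" if "i \<le> n" for i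
      by (rule bidiff_post[OF T[of i] 1[unfolded bidiff_series_def, rule_format, of "n - i"] sums_of_add_le[OF that]])
    then show "(\<lambda>f g. app ((T * ext K S f) $ n) g) \<in> bidiff (sums_of n \<Delta>)"
      unfolding fps_mult_nth app_sum_left by (intro bidiff_sum) simp
  qed
  show ?thesis
    unfolding bidiff_series_def
  proof
    fix n
    have "(\<lambda>f g. app ((T * ext K S f) $ i) (app (S $ (n - i)) g)) \<in> bidiff (sums_of n \<Delta>)" if "i \<le> n" for i
      using bidiff_pre2[OF 2[unfolded bidiff_series_def, rule_format, of i] S[of "n - i"] sums_of_add_le[OF that]] .
    then show "(\<lambda>f g. app ((T * ext K S f * S) $ n) g) \<in> bidiff (sums_of n \<Delta>)"
      unfolding fps_mult_nth[of _ S] app_sum_left by (intro bidiff_sum) simp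
  qed
qed

text \<open>
  In \<open>(\<partial>\<^sub>2\<^sup>m f / m!) U\<^sup>m g\<close> the weight \<open>(0, -m)\<close> of the first factor compensates the shift in
  \<open>diffop_power\<close>.
\<close>

lemma bidiff_series_nord:
  assumes U: "\<And>k. U $ k \<in> diffop {0} ((+) (0, 1) ` sums_of k \<Delta>)"
  shows "bidiff_series \<Delta> (nord U)"
  unfolding bidiff_series_def
proof
  fix n
  have dy_power: "dy ^ m \<in> diffop UNIV {(0, - int m)}" for m
    using diffop_dy_power_mult[OF diffop_one[of "{0}" UNIV], of m] by (simp add: zero_prod_def)
  have "mul (const_poly (1 / fact m)) \<in> diffop UNIV {0}" for m
    by (rule diffop_mul) (auto simp: int_index_def zero_prod_def split: if_splits)
  then have "mul (const_poly (1 / fact m)) * dy ^ m \<in> diffop UNIV {(0, - int m)}" for m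
    by (rule diffop_mult[OF _ dy_power]) auto
  moreover have "(U ^ m) $ n \<in> diffop UNIV ((+) (0, int m) ` sums_of n \<Delta>)" for m
    by (rule diffop_mono[OF diffop_power[OF U order_refl]]) auto
  ultimately have "(\<lambda>f g. app (mul (const_poly (1 / fact m)) * dy ^ m) f * app ((U ^ m) $ n) g)
      \<in> bidiff (sums_of n \<Delta>)" for m
    by (rule bidiff.prod) (auto simp flip: zero_prod_def add.assoc)
  moreover have "app (mul (const_poly (1 / fact m)) * dy ^ m) f = dp2 m f" for m f
  proof -
    have "app dy = pd2" by (simp add: fun_eq_iff)
    then show ?thesis by (simp add: dp2_def app_power)
  qed
  ultimately show "(\<lambda>f g. app (nord U f $ n) g) \<in> bidiff (sums_of n \<Delta>)"
    unfolding nord_nth app_sum_left by (intro bidiff_sum) simp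
qed

text \<open>
  Normal ordering for \<open>- P\<close> has first-order term \<open>- P \<partial>\<^sub>2 f \<partial>\<^sub>1 g\<close>.  The operator
  \<open>E = (1/2) P \<partial>\<^sub>1 \<partial>\<^sub>2\<close> satisfies \<open>E (f g) - (E f) g - f (E g) = (1/2) P (\<partial>\<^sub>1 f \<partial>\<^sub>2 g + \<partial>\<^sub>2 f \<partial>\<^sub>1 g)\<close>,
  so the gauge transformation by \<open>1 + t E\<close> adds exactly the missing symmetric part.
\<close>

theorem star_product_exists:
  assumes P: "\<And>a. a \<in> Poly_Mapping.keys P \<Longrightarrow> int_index a - (1, 1) \<in> \<Delta>"
  obtains K where "additive_map K" "star K" "bidiff_series \<Delta> K" "\<And>f. K f $ 0 = mul f"
    "\<And>f g. app (K f $ 1) g = const_poly (1/2) * (P * (pd1 f * pd2 g - pd2 f * pd1 g))"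
proof -
  have key: "Poly_Mapping.keys (- P) = Poly_Mapping.keys P"
    by (auto simp: in_keys_iff)
  obtain U where U: "normal_ordering (- P) U" "\<And>k. U $ k \<in> diffop {0} ((+) (0, 1) ` sums_of k \<Delta>)"
    "U $ 1 = mul (- P) * dx"
    by (rule normal_ordering_exists[of "- P" \<Delta>]) (auto simp: key P)
  interpret normal_ordering "- P" U by (rule U)
  \<comment> \<open>Minus the operator \<open>E\<close> above, so that the inverse of \<open>1 - t D\<close> is the geometric series of \<open>D\<close>.\<close>
  define D where "D = mul (const_poly (-1/2) * P) * dx * dy"
  define T where "T = 1 - fps_X * fps_const D"
  define S where "S = Abs_fps (\<lambda>n. D ^ n)"
  have ST: "S * T = 1"
  proof (rule fps_ext)
    fix n show "(S * T) $ n = 1 $ n"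
      by (cases n) (simp_all add: S_def T_def right_diff_distrib fps_mult_fps_X_commute power_commutes flip: mult.assoc)
  qed
  have D: "D \<in> diffop UNIV \<Delta>"
  proof -
    have "mul (const_poly (-1/2) * P) \<in> diffop UNIV ((+) (1, 1) ` \<Delta>)"
    proof (rule diffop_mul)
      fix a assume "a \<in> Poly_Mapping.keys (const_poly (-1/2) * P)"
      then have "int_index a - (1, 1) \<in> \<Delta>" using keys_const_mult P by blast
      moreover have "int_index a = (1, 1) + (int_index a - (1, 1))" by simp
      ultimately show "int_index a \<in> (+) (1, 1) ` \<Delta>" by blast
    qed simp
    moreover have "dx * (dy * 1) \<in> diffop UNIV ((+) (-1, 0) ` (+) (0, -1) ` {0})"
      by (intro diffop_dx_mult diffop_dy_mult diffop_one) simp_all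
    ultimately have "mul (const_poly (-1/2) * P) * (dx * (dy * 1)) \<in> diffop UNIV \<Delta>"
    proof (rule diffop_mult)
      fix v w assume "v \<in> (+) (1, 1) ` \<Delta>" "w \<in> (+) (-1, 0) ` (+) (0, -1) ` {0 :: int \<times> int}"
      then show "v + w \<in> \<Delta>" by (auto simp: zero_prod_def)
    qed simp
    then show ?thesis by (simp add: D_def mult.assoc)
  qed
  have D_power: "D ^ n \<in> diffop UNIV (sums_of n \<Delta>)" for n
  proof (induction n)
    case 0
    show ?case by (simp add: diffop_one)
  next
    case (Suc n)
    then show ?case unfolding power_Suc by (rule diffop_mult[OF D]) (auto intro: sums_of_SucI simp del: sums_of.simps)
  qed
  have neg: "- E \<in> diffop UNIV V" if "E \<in> diffop UNIV V" for E V
  proof -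
    have "mul (const_poly (-1)) \<in> diffop UNIV {0}"
      by (rule diffop_mul) (auto simp: int_index_def zero_prod_def split: if_splits)
    then have "mul (const_poly (-1)) * E \<in> diffop UNIV V"
      by (rule diffop_mult[OF _ that]) auto
    moreover have "mul (const_poly (-1)) * E = - E"
      by (rule lop_eqI) (simp add: single_uminus)
    ultimately show ?thesis by simp
  qed
  have T_nth: "T $ n = (if n = 0 then 1 else if n = 1 then - D else 0)" for n
    by (cases n) (auto simp: T_def)
  define K where "K = (\<lambda>f. T * ext (nord U) S f * S)"
  have S_diffop: "S $ n \<in> diffop UNIV (sums_of n \<Delta>)" for n
    using D_power by (simp add: S_def)
  have T_diffop: "T $ n \<in> diffop UNIV (sums_of n \<Delta>)" for n
    using D_power[of n] by (auto simp: T_nth diffop.zero intro: neg)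
  show thesis
  proof
    show "additive_map K" unfolding K_def by (rule additive_gauge[OF additive_nord])
    show "star K" unfolding K_def by (rule gauge_star[OF additive_nord star_nord ST])
    show "bidiff_series \<Delta> K"
      unfolding K_def by (rule bidiff_series_gauge[OF bidiff_series_nord[OF U(2)] S_diffop T_diffop])
    show "K f $ 0 = mul f" for f
      by (simp add: K_def T_nth S_def ext_nth nord_nth)
    show "app (K f $ 1) g = const_poly (1/2) * (P * (pd1 f * pd2 g - pd2 f * pd1 g))" for f g
    proof -
      have "app (K f $ 1) g = - app D (f * g) + f * app D g + app D f * g - P * (pd2 f * pd1 g)"
        using U(3) by (simp add: K_def T_nth S_def ext_nth nord_nth dp2_def algebra_simps)
      also have "\<dots> = const_poly (1/2) * (P * (pd1 f * pd2 g + pd2 f * pd1 g)) - P * (pd2 f * pd1 g)"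
      proof -
        have "const_poly (-1/2) = - const_poly (1/2)"
          by (simp add: single_uminus flip: minus_divide_left)
        then show ?thesis
          by (simp add: D_def pd2_mult pd1_mult pd1_add algebra_simps pd1_pd2_commute)
      qed
      also have "P * (pd2 f * pd1 g) = (const_poly (1/2) + const_poly (1/2)) * (P * (pd2 f * pd1 g))"
        by (simp flip: single_add)
      finally show ?thesis by (simp add: algebra_simps)
    qed
  qed
qed

section \<open>The Maurer-Cartan equation\<close>

lemma sum_apply: "(\<Sum>s\<in>S. \<phi> s) us = (\<Sum>s\<in>S. \<phi> s us)" for \<phi> :: "'a \<Rightarrow> cochain"
  by (induction S rule: infinite_finite_induct) auto

lemma hochschild_2: "hochschild 2 \<phi> [f, g, h] =
    f * \<phi> [g, h] - \<phi> [f * g, h] + \<phi> [f, g * h] - \<phi> [f, g] * h"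
  by (simp add: hochschild_def numeral_2_eq_2)

lemma gerstenhaber_2: "gerstenhaber 2 2 \<phi> \<psi> [f, g, h] =
    (\<phi> [\<psi> [f, g], h] - \<phi> [f, \<psi> [g, h]]) + (\<psi> [\<phi> [f, g], h] - \<psi> [f, \<phi> [g, h]])"
  by (simp add: gerstenhaber_def insert_at_def numeral_2_eq_2)

text \<open>
  The summands \<open>i = 0\<close> and \<open>i = n\<close> of the associativity relation, in which one factor is the
  undeformed product, make up the Hochschild coboundary; the others make up half the bracket, whose
  two insertion sums coincide after reversing the order of summation.
\<close>

lemma maurer_cartan_star:
  fixes B :: "nat \<Rightarrow> bipoly \<Rightarrow> bipoly \<Rightarrow> bipoly"
  assumes B0: "\<And>f g. B 0 f g = f * g" and zero: "\<And>i f. B i f 0 = 0" "\<And>i f. B i 0 f = 0"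
    and assoc: "\<And>n f g h. (\<Sum>i=0..n. B i f (B (n - i) g h)) = (\<Sum>i=0..n. B (n - i) (B i f g) h)"
  shows "maurer_cartan (\<lambda>n. if n = 0 then 0 else bicochain (B n))"
proof -
  define F where "F = (\<lambda>n. if n = 0 then 0 else bicochain (B n))"
  have F: "F n [f, g] = (if n = 0 then 0 else B n f g)" for n f g
    by (simp add: F_def bicochain_def)
  have "hochschild 2 (F n) us = cscale (1/2) (gerstenhaber_series 2 2 F F n) us" for n us
  proof (cases "length us = 3")
    case False
    then show ?thesis
      by (simp add: hochschild_def cscale_def gerstenhaber_series_def gerstenhaber_def sum_apply)
  next
    case True
    then obtain f g h where us: "us = [f, g, h]"
      by (auto simp: length_Suc_conv numeral_3_eq_3)
    let ?l = "\<lambda>i. F i [F (n - i) [f, g], h]" and ?r = "\<lambda>i. F i [f, F (n - i) [g, h]]"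
    have rev: "(\<Sum>i\<le>n. t i) = (\<Sum>i\<le>n. t (n - i))" for t :: "nat \<Rightarrow> bipoly"
      using sum.atLeastAtMost_rev[of t 0 n] by (simp add: atLeast0AtMost)
    have "gerstenhaber_series 2 2 F F n us = (\<Sum>i\<le>n. ?l i - ?r i) + (\<Sum>i\<le>n. F (n - i) [F i [f, g], h] - F (n - i) [f, F i [g, h]])"
      by (simp add: gerstenhaber_series_def sum_apply us gerstenhaber_2 sum.distrib)
    also have "(\<Sum>i\<le>n. F (n - i) [F i [f, g], h] - F (n - i) [f, F i [g, h]]) = (\<Sum>i\<le>n. ?l i - ?r i)"
      by (subst rev) simp
    finally have "gerstenhaber_series 2 2 F F n us = (\<Sum>i\<le>n. ?l i - ?r i) + (\<Sum>i\<le>n. ?l i - ?r i)" .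
    moreover have half: "const_poly (1/2) * (A + A) = A" for A :: bipoly
    proof -
      have "const_poly (1/2) * (A + A) = (const_poly (1/2) + const_poly (1/2)) * A"
        by (simp only: distrib_left distrib_right)
      then show ?thesis by (simp flip: single_add)
    qed
    ultimately have 1: "cscale (1/2) (gerstenhaber_series 2 2 F F n) us = (\<Sum>i\<le>n. ?l i) - (\<Sum>i\<le>n. ?r i)"
      by (simp only: cscale_def sum_subtractf)
    show ?thesis
    proof (cases "n = 0")
      case True
      then show ?thesis unfolding 1 by (simp add: us hochschild_2 F zero)
    next
      case False
      have l: "(\<Sum>i\<le>n. B i (B (n - i) f g) h) = B n (f * g) h + B n f g * h + (\<Sum>i\<le>n. ?l i)"
      proof -
        have "B i (B (n - i) f g) h = (if i = n then B n (f * g) h else 0)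
            + (if i = 0 then B n f g * h else 0) + ?l i" if "i \<le> n" for i
          using that False by (auto simp: F B0 zero)
        then show ?thesis by (simp add: sum.distrib)
      qed
      have r: "(\<Sum>i\<le>n. B i f (B (n - i) g h)) = B n f (g * h) + f * B n g h + (\<Sum>i\<le>n. ?r i)"
      proof -
        have "B i f (B (n - i) g h) = (if i = n then B n f (g * h) else 0)
            + (if i = 0 then f * B n g h else 0) + ?r i" if "i \<le> n" for i
          using that False by (auto simp: F B0 zero)
        then show ?thesis by (simp add: sum.distrib)
      qed
      have "(\<Sum>i\<le>n. B i f (B (n - i) g h)) = (\<Sum>i\<le>n. B i (B (n - i) f g) h)"
        using assoc[of f n g h] by (subst (2) rev) (simp add: atLeast0AtMost)
      then show ?thesis
        using False l r unfolding 1 by (simp add: us hochschild_2 F algebra_simps)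
    qed
  qed
  then show ?thesis
    unfolding maurer_cartan_def hochschild_series_def F_def[symmetric] by (simp add: fun_eq_iff)
qed

lemma cochains_eq_zero: "\<phi> \<in> cochains p \<Longrightarrow> length us \<noteq> p \<Longrightarrow> \<phi> us = 0"
  unfolding cochains_def
  by (induction rule: cochain.span_induct_alt) (auto simp: cscale_def diffmon_def)

text \<open>
  An operator of weight \<open>v\<close> sends the pair of coordinates to a multiple of the monomial with exponent
  \<open>v + (1, 1)\<close>.
\<close>

lemma keys_bivector_of_graded_part:
  assumes "\<phi> \<in> graded_part V" "a \<in> Poly_Mapping.keys (\<phi> [varx, vary])"
  shows "int_index a - (1, 1) \<in> V"
proof -
  define M where "M = {\<phi>::cochain. \<forall>a\<in>Poly_Mapping.keys (\<phi> [varx, vary]). int_index a - (1, 1) \<in> V}"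
  have "cochain.subspace M"
  proof (rule cochain.subspaceI)
    show "0 \<in> M" by (simp add: M_def)
    show "x + y \<in> M" if "x \<in> M" "y \<in> M" for x y
      using that Poly_Mapping.keys_add[of "x [varx, vary]" "y [varx, vary]"] by (auto simp: M_def)
    show "cscale c x \<in> M" if "x \<in> M" for c x
      using that keys_const_mult by (auto simp: M_def cscale_def)
  qed
  moreover have "diffmon a0 as \<in> M" if "weight a0 as \<in> V" for a0 as
  proof -
    have "int_index b - (1, 1) \<in> V" if b: "b \<in> Poly_Mapping.keys (diffmon a0 as [varx, vary])" for b
    proof (cases "length as = 2")
      case True
      then obtain a1 a2 where as: "as = [a1, a2]"
        by (metis (no_types) One_nat_def Suc_1 length_0_conv length_Suc_conv)
      have "b \<in> Poly_Mapping.keys (xpow a0 * (pd a1 varx * pd a2 vary))"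
        using b by (simp add: as diffmon_def)
      then obtain b1 b2 where "b = a0 + (b1 + b2)" "b1 \<in> Poly_Mapping.keys (pd a1 varx)" "b2 \<in> Poly_Mapping.keys (pd a2 vary)"
        using keys_mult[of "xpow a0" "pd a1 varx * pd a2 vary"] keys_mult[of "pd a1 varx" "pd a2 vary"]
        by fastforce
      moreover from keys_pd[OF this(2)] keys_pd[OF this(3)] have "b1 + a1 = (1, 0)" "b2 + a2 = (0, 1)"
        by (simp_all add: varx_def vary_def)
      ultimately have "int_index b - (1, 1) = weight a0 as"
        by (cases a0; cases a1; cases a2; cases b1; cases b2)
          (auto simp: weight_def int_index_def as algebra_simps)
      with that \<open>weight a0 as \<in> V\<close> show ?thesis by simp
    next
      case False
      then show ?thesis using b by (simp add: diffmon_def)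
    qed
    then show ?thesis by (simp add: M_def)
  qed
  then have "weight_space v \<subseteq> M" if "v \<in> V" for v
    unfolding weight_space_def using that \<open>cochain.subspace M\<close>
    by (intro cochain.span_minimal) auto
  ultimately have "graded_part V \<subseteq> M"
    unfolding graded_part_def by (intro cochain.span_minimal) auto
  then show ?thesis using assms by (auto simp: M_def)
qed

theorem proposition5:
  fixes \<Delta> :: "(int \<times> int) set" and \<pi> :: "nat \<Rightarrow> cochain"
  assumes "additive_semigroup \<Delta>"
    and "\<And>k. k \<ge> 1 \<Longrightarrow> \<pi> k \<in> cochains 2"
    and "poisson_bivector (\<pi> 1)"
    and "maurer_cartan (star_series \<pi>)"
    and "\<pi> 1 \<in> graded_part \<Delta>"
  shows "\<exists>\<pi>'. \<pi>' 1 = \<pi> 1 \<and> (\<forall>k\<ge>2. \<pi>' k \<in> cochains 2 \<inter> ideal2 \<Delta>) \<and>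
    maurer_cartan (star_series \<pi>')"
proof -
  obtain P where P: "\<And>f g. \<pi> 1 [f, g] = P * (pd1 f * pd2 g - pd2 f * pd1 g)"
    using assms(3) unfolding poisson_bivector_def by blast
  \<comment> \<open>Since \<open>\<partial>\<^sub>1 x \<partial>\<^sub>2 y - \<partial>\<^sub>2 x \<partial>\<^sub>1 y = 1\<close>.\<close>
  have "P = \<pi> 1 [varx, vary]" unfolding P by simp
  then have keys_P: "int_index a - (1, 1) \<in> \<Delta>" if "a \<in> Poly_Mapping.keys P" for a
    using keys_bivector_of_graded_part[OF assms(5)] that by simp
  obtain K where K: "additive_map K" "star K" "bidiff_series \<Delta> K" "\<And>f. K f $ 0 = mul f"
    "\<And>f g. app (K f $ 1) g = const_poly (1/2) * (P * (pd1 f * pd2 g - pd2 f * pd1 g))"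
    using star_product_exists[of P \<Delta>, OF keys_P] by blast
  define B where "B = (\<lambda>n f g. app (K f $ n) g)"
  define \<pi>' where "\<pi>' = (\<lambda>k. if k = 1 then \<pi> 1 else bicochain (B k))"
  have "\<pi>' k \<in> cochains 2 \<inter> ideal2 \<Delta>" if "k \<ge> 2" for k
  proof -
    have "B k \<in> bidiff {a + b | a b. a \<in> \<Delta> \<and> b \<in> \<Delta>}"
      using K(3) sums_of_ideal2[OF assms(1) that]
      unfolding bidiff_series_def B_def by (blast intro: bidiff_mono)
    then show ?thesis
      using that bicochain_in_cochains bicochain_in_graded_part
      by (auto simp: \<pi>'_def ideal2_def)
  qed
  moreover have "maurer_cartan (star_series \<pi>')"
  proof -
    have "cscale (1/2) (\<pi> 1) us = bicochain (B 1) us" for us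
    proof (cases "length us = 2")
      case True
      then obtain f g where "us = [f, g]"
        by (metis (no_types) One_nat_def Suc_1 length_0_conv length_Suc_conv)
      then show ?thesis using P K(5)[of f g] by (simp add: bicochain_def cscale_def B_def)
    next
      case False
      moreover have "\<pi> 1 us = 0"
        using cochains_eq_zero[OF _ False] assms(2) by simp
      ultimately show ?thesis by (simp add: bicochain_def cscale_def)
    qed
    then have "star_series \<pi>' = (\<lambda>n. if n = 0 then 0 else bicochain (B n))"
      by (auto simp: star_series_def \<pi>'_def fun_eq_iff)
    moreover have "maurer_cartan (\<lambda>n. if n = 0 then 0 else bicochain (B n))"
    proof (rule maurer_cartan_star)
      show "(\<Sum>i=0..n. B i f (B (n - i) g h)) = (\<Sum>i=0..n. B (n - i) (B i f g) h)" for n f g h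
      proof -
        have "app ((K f * K g) $ n) h = app (ext K (K f) g $ n) h"
          using K(2) by (simp add: star_def)
        then show ?thesis by (simp add: fps_mult_nth ext_nth app_sum_left B_def)
      qed
    qed (use K(4) additive_zero[OF K(1)] in \<open>simp_all add: B_def\<close>)
    ultimately show ?thesis by simp
  qed
  ultimately show ?thesis
    by (intro exI[of _ \<pi>']) (simp add: \<pi>'_def)
qed

end
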